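(* Let $P_n$ be a sequence of finite semiorders with $|P_n|\to\infty$. Then the following are equivalent: (i) $P_n$ converges to a poset limit. (ii) The distributions $\nu_-(P_n)$ converge (weakly, to some probability distribution on $[0,1]$). (iii) The distributions $\nu_+(P_n)$ converge (weakly, to some probability distribution on $[0,1]$). The poset limit in (i) is necessarily a semiorder limit. If $\nu_-(P_n)\to\nu_-$, then $P_n\to\Pi_g$, where $g=F_-$ is the distribution function of $\nu_-$. Thus $g(t)=\lim_n F_{\nu_-(P_n)}(t)$ for every continuity point $t$ of $g$ (regarded as a distribution function on $\mathbb R$). If $\nu_+(P_n)\to\nu_+$, then $P_n\to\Pi_g$, where $g$ is given by $$g(x)=1-\min\{t:1-F_+(t)\le x\}=\max\{s:F_+(1-s)\ge1-x\},\qquad x\in[0,1],\qquad ( * )$$ with $s,t$ ranging over $[0,1]$ and $F_+(t)$ the distribution function of $\nu_+$. Thus $F_+(t)=\lim_n F_{\nu_+(P_n)}(t)$ for every continuity point $t$ of $F_+$ (regarded as a distribution function on $\mathbb R$), and we can replace $F_+$ by $\limsup_n F_{\nu_+(P_n)}(t)$ in $( * )$.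
   Context: Posets are non-empty. $\mathcal P$ is the set of unlabelled finite posets. For finite posets $Q,P$, $t(Q,P)$ is the proportion of all maps $\varphi:Q\to P$ such that $x<_Q y\Rightarrow \varphi(x)<_P\varphi(y)$. A sequence of finite posets $P_n$ with $|P_n|\to\infty$ converges if $t(Q,P_n)$ converges for every finite poset $Q$. The discrete space $\mathcal P$ embeds as an open dense subspace of a compact metric space $\overline{\mathcal P}$ such that, for a sequence $P_n$ of finite posets with $|P_n|\to\infty$, $t(Q,P_n)$ converges for every finite poset $Q$ iff $P_n$ converges in $\overline{\mathcal P}$; concretely, $\overline{\mathcal P}$ is the closure of the image of $P\mapsto\bigl((t(Q,P))_{Q\in\mathcal P},1/|P|\bigr)$ in $[0,1]^{\mathcal P}\times[0,1]$. Elements of $\mathcal P_\infty:=\overline{\mathcal P}\setminus\mathcal P$ are poset limits. Each $t(Q,\cdot)$ extends continuously to $\overline{\mathcal P}$, and a poset limit $\Pi$ is determined by the numbers $t(Q,\Pi)$, $Q\in\mathcal P$. For a finite poset $P$ and $x\in P$, $d_-(x)=|\{y\in P:y<x\}|$ and $d_+(x)=|\{y\in P:y>x\}|$; $\nu_\pm(P)$ is the distribution (a probability measure on $[0,1]$) of $d_\pm(X)/|P|$ where $X$ is a uniformly random point of $P$. The distribution function of a probability measure $\nu$ on $\mathbb R$ is $F_\nu(t)=\nu(-\infty,t]$; for $\nu$ on $[0,1]$ it is also regarded as a function on $[0,1]$. A semiorder is a partial order with no induced subposet isomorphic to $\mathbf2+\mathbf2$ (elements $1,2,3,4$, only strict relations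 $1<2$ and $3<4$) or to $\mathbf3+\mathbf1$ (elements $1,2,3,4$ with $1<2<3$ and $4$ incomparable to the others). A semiorder limit is a poset limit that is the limit of a sequence of finite semiordered posets. For a weakly increasing $g:[0,1]\to[0,1]$ with $g(x)\ge x$ for all $x$, let $W_g(x,y)=1$ if $g(x)<y$ and $0$ otherwise, for $x,y\in[0,1]$. $\Pi_g$ is the unique poset limit with $t(Q,\Pi_g)=\int_{[0,1]^{|Q|}}\prod_{ij:\,i<_Qj}W_g(x_i,x_j)\,dx_1\cdots dx_{|Q|}$ for all $Q\in\mathcal P$.
   Formalization: In the last clause, where F_+ is replaced by limsup_n F_{ν_+(P_n)} in ( * ), min and max are read as inf and sup, because the limsup need not be right-continuous and the min and max may fail to exist; where they exist the values agree. *)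

theory Defs
  imports "HOL-Probability.Probability"
begin

subsection \<open>Finite posets\<close>

text \<open>A labelled poset is a carrier together with its (reflexive) order relation.\<close>

type_synonym 'a lposet = "'a set \<times> 'a rel"

definition finite_poset :: "'a lposet \<Rightarrow> bool" where
  "finite_poset P \<longleftrightarrow> finite (fst P) \<and> fst P \<noteq> {} \<and> partial_order_on (fst P) (snd P)"

definition lless :: "'a lposet \<Rightarrow> 'a \<Rightarrow> 'a \<Rightarrow> bool" where
  "lless P x y \<longleftrightarrow> (x, y) \<in> snd P \<and> x \<noteq> y"

definition liso_via :: "('a \<Rightarrow> 'b) \<Rightarrow> 'a lposet \<Rightarrow> 'b lposet \<Rightarrow> bool" where
  "liso_via f P Q \<longleftrightarrow> bij_betw f (fst P) (fst Q) \<and>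
     (\<forall>x\<in>fst P. \<forall>y\<in>fst P. (x, y) \<in> snd P \<longleftrightarrow> (f x, f y) \<in> snd Q)"

definition liso :: "'a lposet \<Rightarrow> 'b lposet \<Rightarrow> bool" where
  "liso P Q \<longleftrightarrow> (\<exists>f. liso_via f P Q)"

definition lhoms :: "'a lposet \<Rightarrow> 'b lposet \<Rightarrow> ('a \<Rightarrow> 'b) set" where
  "lhoms Q P = {\<phi> \<in> fst Q \<rightarrow>\<^sub>E fst P.
     \<forall>x\<in>fst Q. \<forall>y\<in>fst Q. lless Q x y \<longrightarrow> lless P (\<phi> x) (\<phi> y)}"

definition lhom_density :: "'a lposet \<Rightarrow> 'b lposet \<Rightarrow> real" where
  "lhom_density Q P = real (card (lhoms Q P)) / real (card (fst Q \<rightarrow>\<^sub>E fst P))"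

definition ldeg_minus :: "'a lposet \<Rightarrow> 'a \<Rightarrow> nat" where
  "ldeg_minus P x = card {y \<in> fst P. lless P y x}"

definition ldeg_plus :: "'a lposet \<Rightarrow> 'a \<Rightarrow> nat" where
  "ldeg_plus P x = card {y \<in> fst P. lless P x y}"

definition lnu_minus :: "'a lposet \<Rightarrow> real measure" where
  "lnu_minus P = distr (measure_pmf (pmf_of_set (fst P))) borel
     (\<lambda>x. real (ldeg_minus P x) / real (card (fst P)))"

definition lnu_plus :: "'a lposet \<Rightarrow> real measure" where
  "lnu_plus P = distr (measure_pmf (pmf_of_set (fst P))) borel
     (\<lambda>x. real (ldeg_plus P x) / real (card (fst P)))"

definition induced :: "'a lposet \<Rightarrow> 'a set \<Rightarrow> 'a lposet" where
  "induced P B = (B, snd P \<inter> B \<times> B)"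

definition two_plus_two :: "nat lposet" where
  "two_plus_two = ({1,2,3,4}, Id_on {1,2,3,4} \<union> {(1,2), (3,4)})"

definition three_plus_one :: "nat lposet" where
  "three_plus_one = ({1,2,3,4}, Id_on {1,2,3,4} \<union> {(1,2), (2,3), (1,3)})"

definition lsemiorder :: "'a lposet \<Rightarrow> bool" where
  "lsemiorder P \<longleftrightarrow>
     \<not> (\<exists>B\<subseteq>fst P. liso (induced P B) two_plus_two \<or> liso (induced P B) three_plus_one)"


subsection \<open>Invariance under isomorphism\<close>

lemma liso_via_id: "liso_via id P P"
  by (simp add: liso_via_def)

lemma liso_via_inv:
  assumes "liso_via f P Q" shows "liso_via (inv_into (fst P) f) Q P"
proof -
  let ?k = "inv_into (fst P) f"
  have b: "bij_betw f (fst P) (fst Q)" using assms by (simp add: liso_via_def)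
  have k: "bij_betw ?k (fst Q) (fst P)" by (rule bij_betw_inv_into[OF b])
  have "(x, y) \<in> snd Q \<longleftrightarrow> (?k x, ?k y) \<in> snd P" if "x \<in> fst Q" "y \<in> fst Q" for x y
  proof -
    have "?k x \<in> fst P" "?k y \<in> fst P" using k that by (auto dest: bij_betwE)
    then have "(?k x, ?k y) \<in> snd P \<longleftrightarrow> (f (?k x), f (?k y)) \<in> snd Q"
      using assms by (simp add: liso_via_def)
    then show ?thesis using bij_betw_inv_into_right[OF b] that by simp
  qed
  then show ?thesis using k by (simp add: liso_via_def)
qed

lemma liso_via_comp:
  assumes "liso_via f P Q" "liso_via g Q R" shows "liso_via (g \<circ> f) P R"
  using assms unfolding liso_via_def
  by (auto intro: bij_betw_trans dest: bij_betwE)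

lemma liso_sym: "liso P Q \<Longrightarrow> liso Q P"
  by (auto simp: liso_def dest: liso_via_inv)

lemma liso_trans: "liso P Q \<Longrightarrow> liso Q R \<Longrightarrow> liso P R"
  by (auto simp: liso_def dest: liso_via_comp)

lemma liso_via_lless:
  assumes "liso_via f P Q" "x \<in> fst P" "y \<in> fst P"
  shows "lless Q (f x) (f y) \<longleftrightarrow> lless P x y"
  using assms by (auto simp: liso_via_def lless_def bij_betw_def inj_on_def)

lemma liso_card: "liso P Q \<Longrightarrow> card (fst P) = card (fst Q)"
  unfolding liso_def liso_via_def using bij_betw_same_card by blast

lemma card_lhoms_le:
  assumes f: "liso_via f P P'" and h: "liso_via h Q Q'"
    and fin: "finite (fst Q')" "finite (fst P')"
  shows "card (lhoms Q P) \<le> card (lhoms Q' P')"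
proof (rule card_inj_on_le)
  let ?k = "inv_into (fst Q) h"
  let ?T = "\<lambda>\<phi>. restrict (f \<circ> \<phi> \<circ> ?k) (fst Q')"
  have k: "liso_via ?k Q' Q" by (rule liso_via_inv[OF h])
  have kQ: "?k y \<in> fst Q" if "y \<in> fst Q'" for y
    using k that by (auto simp: liso_via_def dest: bij_betwE)
  have fP: "f x \<in> fst P'" if "x \<in> fst P" for x
    using f that by (auto simp: liso_via_def dest: bij_betwE)
  show "inj_on ?T (lhoms Q P)"
  proof (rule inj_onI)
    fix \<phi> \<psi> assume a: "\<phi> \<in> lhoms Q P" "\<psi> \<in> lhoms Q P" "?T \<phi> = ?T \<psi>"
    have "\<phi> x = \<psi> x" if x: "x \<in> fst Q" for x
    proof -
      have hx: "h x \<in> fst Q'" using h x by (auto simp: liso_via_def dest: bij_betwE)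
      have khx: "?k (h x) = x" using h x by (auto simp: liso_via_def bij_betw_def)
      have "?T \<phi> (h x) = ?T \<psi> (h x)" using a(3) by simp
      then have "f (\<phi> x) = f (\<psi> x)" using hx khx by simp
      moreover have "\<phi> x \<in> fst P" "\<psi> x \<in> fst P" using a x by (auto simp: lhoms_def)
      ultimately show ?thesis using f by (auto simp: liso_via_def bij_betw_def inj_on_def)
    qed
    then show "\<phi> = \<psi>" using a(1,2) by (intro PiE_ext[of _ "fst Q"]) (auto simp: lhoms_def)
  qed
  show "?T ` lhoms Q P \<subseteq> lhoms Q' P'"
  proof
    fix u assume "u \<in> ?T ` lhoms Q P"
    then obtain \<phi> where p: "\<phi> \<in> lhoms Q P" and c: "u = ?T \<phi>" by blast
    have pP: "\<phi> x \<in> fst P" if "x \<in> fst Q" for x using p that by (auto simp: lhoms_def)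
    have "lless P' (u x) (u y)" if "x \<in> fst Q'" "y \<in> fst Q'" "lless Q' x y" for x y
    proof -
      have "lless Q (?k x) (?k y)" using liso_via_lless[OF k that(1,2)] that(3) by simp
      then have "lless P (\<phi> (?k x)) (\<phi> (?k y))"
        using p kQ that(1,2) by (simp add: lhoms_def)
      then show ?thesis
        using liso_via_lless[OF f pP[OF kQ[OF that(1)]] pP[OF kQ[OF that(2)]]] c that by simp
    qed
    moreover have "u \<in> fst Q' \<rightarrow>\<^sub>E fst P'" using c fP pP kQ by auto
    ultimately show "u \<in> lhoms Q' P'" by (simp add: lhoms_def)
  qed
  have "finite (fst Q' \<rightarrow>\<^sub>E fst P')" using fin by (simp add: finite_PiE)
  then show "finite (lhoms Q' P')" unfolding lhoms_def by (rule rev_finite_subset) blast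
qed

lemma lhom_density_cong:
  assumes "liso P P'" "liso Q Q'" "finite_poset P" "finite_poset P'"
    "finite_poset Q" "finite_poset Q'"
  shows "lhom_density Q P = lhom_density Q' P'"
proof -
  have "card (lhoms Q P) = card (lhoms Q' P')"
  proof -
    obtain f h where f: "liso_via f P P'" and h: "liso_via h Q Q'"
      using assms(1,2) by (auto simp: liso_def)
    show ?thesis
      using assms(3-6) card_lhoms_le[OF f h] card_lhoms_le[OF f[THEN liso_via_inv] h[THEN liso_via_inv]]
      by (auto simp: finite_poset_def)
  qed
  moreover have "card (fst Q \<rightarrow>\<^sub>E fst P) = card (fst Q' \<rightarrow>\<^sub>E fst P')"
    using assms(3-6) liso_card[OF assms(1)] liso_card[OF assms(2)]
    by (simp add: card_PiE finite_poset_def)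
  ultimately show ?thesis by (simp add: lhom_density_def)
qed

lemma ldeg_cong:
  assumes f: "liso_via f P Q" and x: "x \<in> fst P"
  shows "ldeg_minus Q (f x) = ldeg_minus P x" "ldeg_plus Q (f x) = ldeg_plus P x"
proof -
  have b: "bij_betw f (fst P) (fst Q)" using f by (simp add: liso_via_def)
  have i: "f ` fst P = fst Q" "inj_on f (fst P)" using b by (auto simp: bij_betw_def)
  have "{y \<in> fst Q. lless Q y (f x)} = f ` {y \<in> fst P. lless P y x}"
    unfolding i(1)[symmetric] using liso_via_lless[OF f _ x] by blast
  moreover have "{y \<in> fst Q. lless Q (f x) y} = f ` {y \<in> fst P. lless P x y}"
    unfolding i(1)[symmetric] using liso_via_lless[OF f x] by blast
  ultimately show "ldeg_minus Q (f x) = ldeg_minus P x" "ldeg_plus Q (f x) = ldeg_plus P x"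
    unfolding ldeg_minus_def ldeg_plus_def
    using i(2) by (auto intro!: card_image inj_on_subset[OF i(2)])
qed

lemma lnu_cong:
  assumes "liso P Q" "finite_poset P"
  shows "lnu_minus P = lnu_minus Q" "lnu_plus P = lnu_plus Q"
proof -
  obtain f where f: "liso_via f P Q" using assms(1) by (auto simp: liso_def)
  have fin: "fst P \<noteq> {}" "finite (fst P)" using assms(2) by (auto simp: finite_poset_def)
  have m: "pmf_of_set (fst Q) = map_pmf f (pmf_of_set (fst P))"
    using f fin by (intro map_pmf_of_set_bij_betw[symmetric]) (auto simp: liso_via_def)
  have c: "card (fst P) = card (fst Q)" using liso_card[OF assms(1)] .
  have *: "distr (measure_pmf (pmf_of_set (fst P))) borel (\<lambda>x. real (d x) / real (card (fst P)))
       = distr (measure_pmf (pmf_of_set (fst Q))) borel (\<lambda>x. real (e x) / real (card (fst Q)))"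
    if "\<And>x. x \<in> fst P \<Longrightarrow> e (f x) = d x" for d e
  proof -
    have "distr (measure_pmf (pmf_of_set (fst Q))) borel (\<lambda>x. real (e x) / real (card (fst Q)))
      = distr (measure_pmf (pmf_of_set (fst P))) borel (\<lambda>x. real (e (f x)) / real (card (fst Q)))"
      unfolding m map_pmf_rep_eq by (subst distr_distr) (auto simp: comp_def)
    also have "\<dots> = distr (measure_pmf (pmf_of_set (fst P))) borel
        (\<lambda>x. real (d x) / real (card (fst P)))"
      using that fin c by (intro distr_cong_AE) (auto simp: AE_measure_pmf_iff)
    finally show ?thesis by simp
  qed
  show "lnu_minus P = lnu_minus Q" unfolding lnu_minus_def by (rule *) (rule ldeg_cong(1)[OF f])
  show "lnu_plus P = lnu_plus Q" unfolding lnu_plus_def by (rule *) (rule ldeg_cong(2)[OF f])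
qed

lemma lsemiorder_mono:
  assumes "liso P Q" "lsemiorder Q"
  shows "lsemiorder P"
proof -
  obtain f where f: "liso_via f P Q" using assms(1) by (auto simp: liso_def)
  have ind: "f ` B \<subseteq> fst Q \<and> liso (induced P B) (induced Q (f ` B))" if "B \<subseteq> fst P" for B
  proof -
    have "liso_via f (induced P B) (induced Q (f ` B))"
      using f that unfolding liso_via_def induced_def bij_betw_def
      by (auto intro: inj_on_subset)
    moreover have "f ` B \<subseteq> fst Q"
      using f image_mono[OF that, of f] by (simp add: liso_via_def bij_betw_def)
    ultimately show ?thesis unfolding liso_def by blast
  qed
  show ?thesis
    unfolding lsemiorder_def
  proof clarify
    fix B assume B: "B \<subseteq> fst P"
      and "liso (induced P B) two_plus_two \<or> liso (induced P B) three_plus_one"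
    then have "liso (induced Q (f ` B)) two_plus_two \<or> liso (induced Q (f ` B)) three_plus_one"
      using liso_trans[OF liso_sym[OF conjunct2[OF ind[OF B]]], of two_plus_two]
        liso_trans[OF liso_sym[OF conjunct2[OF ind[OF B]]], of three_plus_one] by argo
    then show False using assms(2) ind[OF B] by (auto simp: lsemiorder_def)
  qed
qed


subsection \<open>Unlabelled finite posets\<close>

text \<open>Every finite poset is isomorphic to one whose points are natural numbers, so isomorphism
  classes of the latter are all unlabelled finite posets.\<close>

definition liso_fin :: "nat lposet \<Rightarrow> nat lposet \<Rightarrow> bool" where
  "liso_fin P Q \<longleftrightarrow> finite_poset P \<and> finite_poset Q \<and> liso P Q"

quotient_type uposet = "nat lposet" / partial: liso_fin
proof (rule part_equivpI)
  have "finite_poset ({0::nat}, {(0,0)})"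
    by (auto simp: finite_poset_def partial_order_on_def preorder_on_def refl_on_def
        trans_def antisym_def)
  then show "\<exists>P. liso_fin P P"
    using liso_via_id unfolding liso_fin_def liso_def by blast
  show "symp liso_fin" by (rule sympI) (simp add: liso_fin_def liso_sym)
  show "transp liso_fin" 
  proof (rule transpI)
    fix P Q R assume "liso_fin P Q" "liso_fin Q R"
    then show "liso_fin P R" using liso_trans[of P Q R] by (simp add: liso_fin_def)
  qed
qed

lift_definition psize :: "uposet \<Rightarrow> nat" is "\<lambda>P. card (fst P)"
  by (auto simp: liso_fin_def liso_card)

lift_definition hom_density :: "uposet \<Rightarrow> uposet \<Rightarrow> real" is lhom_density
  by (auto simp: liso_fin_def intro: lhom_density_cong)

lift_definition nu_minus :: "uposet \<Rightarrow> real measure" is lnu_minus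
  by (auto simp: liso_fin_def intro: lnu_cong)

lift_definition nu_plus :: "uposet \<Rightarrow> real measure" is lnu_plus
  by (auto simp: liso_fin_def intro: lnu_cong)

lift_definition semiorder :: "uposet \<Rightarrow> bool" is lsemiorder
proof -
  fix P Q assume "liso_fin P Q"
  then have "liso P Q" "liso Q P" by (simp_all add: liso_fin_def liso_sym)
  then show "lsemiorder P = lsemiorder Q" using lsemiorder_mono[of P Q] lsemiorder_mono[of Q P] by argo
qed


subsection \<open>The compactification and poset limits\<close>

text \<open>The function type carries the product topology. All coordinates of the embedding lie in
  \<open>[0,1]\<close>, so taking the closure in the full product space changes nothing.\<close>

definition poset_emb :: "uposet \<Rightarrow> (uposet \<Rightarrow> real) \<times> real" where
  "poset_emb P = ((\<lambda>Q. hom_density Q P), 1 / real (psize P))"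

definition poset_bar :: "((uposet \<Rightarrow> real) \<times> real) set" where
  "poset_bar = closure (range poset_emb)"

definition poset_limits :: "((uposet \<Rightarrow> real) \<times> real) set" where
  "poset_limits = poset_bar - range poset_emb"

text \<open>The continuous extension of \<open>hom_density Q\<close> to \<open>poset_bar\<close> is the coordinate projection.\<close>

definition density_bar :: "uposet \<Rightarrow> (uposet \<Rightarrow> real) \<times> real \<Rightarrow> real" where
  "density_bar Q L = fst L Q"

definition converges_to_limit :: "(nat \<Rightarrow> uposet) \<Rightarrow> (uposet \<Rightarrow> real) \<times> real \<Rightarrow> bool" where
  "converges_to_limit P L \<longleftrightarrow> L \<in> poset_limits \<and> (\<lambda>n. poset_emb (P n)) \<longlonglongrightarrow> L"

definition semiorder_limit :: "(uposet \<Rightarrow> real) \<times> real \<Rightarrow> bool" where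
  "semiorder_limit L \<longleftrightarrow> (\<exists>S. (\<forall>n. semiorder (S n)) \<and> converges_to_limit S L)"


subsection \<open>The limits given by monotone functions\<close>

definition admissible :: "(real \<Rightarrow> real) \<Rightarrow> bool" where
  "admissible g \<longleftrightarrow> g ` {0..1} \<subseteq> {0..1} \<and> mono_on {0..1} g \<and> (\<forall>x\<in>{0..1}. x \<le> g x)"

definition W :: "(real \<Rightarrow> real) \<Rightarrow> real \<Rightarrow> real \<Rightarrow> real" where
  "W g x y = (if g x < y then 1 else 0)"

definition W_density :: "(real \<Rightarrow> real) \<Rightarrow> 'a lposet \<Rightarrow> real" where
  "W_density g Q =
     (LINT x | (\<Pi>\<^sub>M i\<in>fst Q. restrict_space lborel {0..1}).
        (\<Prod>(i, j) \<in> {(i, j). i \<in> fst Q \<and> j \<in> fst Q \<and> lless Q i j}. W g (x i) (x j)))"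

text \<open>The integral formula is imposed on every labelled representative of every
  unlabelled poset; \<open>abs_uposet Q\<close> is the isomorphism class of \<open>Q\<close>.\<close>

definition Pi_lim :: "(real \<Rightarrow> real) \<Rightarrow> (uposet \<Rightarrow> real) \<times> real" where
  "Pi_lim g = (THE L. L \<in> poset_limits \<and>
     (\<forall>Q. finite_poset Q \<longrightarrow> density_bar (abs_uposet Q) L = W_density g Q))"


subsection \<open>Distributions on the unit interval\<close>

definition unit_distribution :: "real measure \<Rightarrow> bool" where
  "unit_distribution \<nu> \<longleftrightarrow> real_distribution \<nu> \<and> measure \<nu> {0..1} = 1"

definition is_min :: "real set \<Rightarrow> real \<Rightarrow> bool" where
  "is_min S m \<longleftrightarrow> m \<in> S \<and> (\<forall>y\<in>S. m \<le> y)"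

definition is_max :: "real set \<Rightarrow> real \<Rightarrow> bool" where
  "is_max S m \<longleftrightarrow> m \<in> S \<and> (\<forall>y\<in>S. y \<le> m)"

definition min_set :: "(real \<Rightarrow> real) \<Rightarrow> real \<Rightarrow> real set" where
  "min_set F x = {t \<in> {0..1}. 1 - F t \<le> x}"

definition max_set :: "(real \<Rightarrow> real) \<Rightarrow> real \<Rightarrow> real set" where
  "max_set F x = {s \<in> {0..1}. F (1 - s) \<ge> 1 - x}"

text \<open>Distribution functions take values in \<open>[0,1]\<close>, so the upper limit is finite. It need not be
  right-continuous, so \<open>min_set\<close> and \<open>max_set\<close> of it are bounded but may fail to have a
  least, respectively greatest, element.\<close>

definition limsup_cdf :: "(nat \<Rightarrow> real measure) \<Rightarrow> real \<Rightarrow> real" where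
  "limsup_cdf \<nu> t = real_of_ereal (limsup (\<lambda>n. ereal (cdf (\<nu> n) t)))"

end

theory Submission
  imports Defs
begin

text \<open>
  In a semiorder all down-sets and all up-sets are nested, and excluding \<open>3+1\<close> makes the two
  nestings compatible. Ranking the \<open>N\<close> points accordingly, \<open>p < q\<close> holds iff the rank of \<open>p\<close> is less
  than \<open>d\<^sub>-(q)\<close>, iff the rank of \<open>q\<close> is at least \<open>N - d\<^sub>+(p)\<close>. Attach to \<open>p\<close> the open interval
  \<open>(r(p)/N, (r(p)+1)/N)\<close>. With \<open>F\<close> and \<open>G\<close> the distribution functions of \<open>\<nu>\<^sub>-\<close> and \<open>\<nu>\<^sub>+\<close>, for \<open>x\<close> in
  the interval of \<open>p\<close> and \<open>y\<close> in that of \<open>q\<close> the relation \<open>p < q\<close> is equivalent both to \<open>F x < y\<close> and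
  to \<open>G (1 - y) < 1 - x\<close>. Hence homomorphism densities are \<^emph>\<open>exactly\<close> integrals of these kernels, and
  weak convergence of \<open>\<nu>\<^sub>-\<close> or \<open>\<nu>\<^sub>+\<close> passes to the limit by dominated convergence. Conversely the
  moments of \<open>\<nu>\<^sub>-\<close> and \<open>\<nu>\<^sub>+\<close> are the densities of stars, and on \<open>[0,1]\<close> convergence of all moments
  implies weak convergence.
\<close>

subsection \<open>Ranking a finite semiorder\<close>

lemma lless_irrefl: "\<not> lless P x x"
  by (simp add: lless_def)

lemma lless_trans:
  assumes "finite_poset P" "lless P x y" "lless P y z"
  shows "lless P x z"
  using assms unfolding finite_poset_def partial_order_on_def preorder_on_def lless_def
  by (metis antisymD transD)

lemma lless_carrier:
  assumes "finite_poset P" "lless P x y"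
  shows "x \<in> fst P" "y \<in> fst P"
  using assms unfolding finite_poset_def partial_order_on_def preorder_on_def refl_on_def lless_def
  by auto

lemma finite_poset_refl: "finite_poset P \<Longrightarrow> x \<in> fst P \<Longrightarrow> (x, x) \<in> snd P"
  unfolding finite_poset_def partial_order_on_def preorder_on_def refl_on_def by auto

text \<open>Shared isomorphism check for the two forbidden subposets: reading
  \<open>[a, b, c, d]\<close> as a numbering of the four points leaves sixteen pairs to compare.
  Labels in \<open>Q\<close> start at 1, list positions at 0, hence the \<open>Suc\<close>.\<close>

lemma liso_via_four:
  fixes Q :: "nat lposet"
  assumes P: "finite_poset P" and sub: "{a, b, c, d} \<subseteq> fst P" and dist: "distinct [a, b, c, d]"
    and Q: "fst Q = {1, 2, 3, 4}"
    and eq: "\<And>i j. i < 4 \<Longrightarrow> j < 4 \<Longrightarrow>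
      (Suc i, Suc j) \<in> snd Q \<longleftrightarrow> i = j \<or> lless P ([a, b, c, d] ! i) ([a, b, c, d] ! j)"
  shows "liso (induced P {a, b, c, d}) Q"
proof -
  define f where "f i = [a, b, c, d] ! (i - 1)" for i :: nat
  have f: "f 1 = a" "f 2 = b" "f 3 = c" "f 4 = d" by (simp_all add: f_def)
  have "liso_via f Q (induced P {a, b, c, d})"
    unfolding liso_via_def
  proof (intro conjI ballI)
    show "bij_betw f (fst Q) (fst (induced P {a, b, c, d}))"
      using dist f unfolding Q bij_betw_def induced_def by auto
    fix x y assume "x \<in> fst Q" "y \<in> fst Q"
    then have xy: "x \<in> {1, 2, 3, 4}" "y \<in> {1, 2, 3, 4}" by (simp_all add: Q)
    then have "f x \<in> {a, b, c, d}" "f y \<in> {a, b, c, d}" using f by auto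
    moreover have "(x, y) \<in> snd Q \<longleftrightarrow> (f x, f y) \<in> snd P"
    proof -
      obtain i j where ij: "x = Suc i" "y = Suc j" "i < 4" "j < 4"
        using xy by (cases x; cases y) auto
      have "[a, b, c, d] ! i \<in> set [a, b, c, d]" using ij by (intro nth_mem) simp
      then have "([a, b, c, d] ! i, [a, b, c, d] ! i) \<in> snd P"
        using sub finite_poset_refl[OF P] by auto
      moreover have "[a, b, c, d] ! i = [a, b, c, d] ! j \<longleftrightarrow> i = j"
        using nth_eq_iff_index_eq[OF dist] ij by simp
      ultimately show ?thesis using eq[of i j] ij unfolding f_def lless_def by auto
    qed
    ultimately show "(x, y) \<in> snd Q \<longleftrightarrow> (f x, f y) \<in> snd (induced P {a, b, c, d})"
      by (auto simp: induced_def)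
  qed
  then show ?thesis using liso_sym liso_def by blast
qed

text \<open>If both alternatives fail, any further relation or coincidence among the four points
  yields, by transitivity, \<open>a < d\<close>, \<open>c < b\<close> or a loop. So the four points
  would induce exactly \<open>two_plus_two\<close>.\<close>

lemma semiorder_no_two_plus_two:
  assumes P: "finite_poset P" "lsemiorder P" and "lless P a b" "lless P c d"
  shows "lless P a d \<or> lless P c b"
proof (rule ccontr)
  assume n: "\<not> (lless P a d \<or> lless P c b)"
  note tr = lless_trans[OF P(1)]
  have car: "{a, b, c, d} \<subseteq> fst P" using lless_carrier[OF P(1)] assms(3,4) by blast
  have "a \<noteq> b" "a \<noteq> c" "a \<noteq> d" "b \<noteq> c" "b \<noteq> d" "c \<noteq> d"
    using n assms(3,4) tr lless_irrefl[of P] by blast+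
  then have dist: "distinct [a, b, c, d]" by simp
  have neg: "\<not> lless P a c" "\<not> lless P a d" "\<not> lless P b a" "\<not> lless P b c" "\<not> lless P b d"
    "\<not> lless P c a" "\<not> lless P c b" "\<not> lless P d a" "\<not> lless P d b" "\<not> lless P d c"
    using n assms(3,4) tr lless_irrefl[of P] by blast+
  have "liso (induced P {a, b, c, d}) two_plus_two"
  proof (rule liso_via_four[OF P(1) car dist])
    fix i j :: nat assume "i < 4" "j < 4"
    then have "i \<in> {0, 1, 2, 3}" "j \<in> {0, 1, 2, 3}" by auto
    then show "(Suc i, Suc j) \<in> snd two_plus_two \<longleftrightarrow>
        i = j \<or> lless P ([a, b, c, d] ! i) ([a, b, c, d] ! j)"
      using neg assms(3,4) lless_irrefl[of P] by (elim insertE emptyE) (simp_all add: two_plus_two_def Id_on_iff)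
  qed (simp add: two_plus_two_def)
  then show False using P(2) car unfolding lsemiorder_def by blast
qed

text \<open>If both alternatives fail, then \<open>d\<close> is incomparable to the whole chain: a
  relation with any of its points extends along the chain to \<open>a < d\<close> or
  \<open>d < c\<close>. The carrier assumption on \<open>d\<close> is explicit because
  \<open>d\<close> occurs in no assumed relation.\<close>

lemma semiorder_no_three_plus_one:
  assumes P: "finite_poset P" "lsemiorder P" and "lless P a b" "lless P b c" "d \<in> fst P"
  shows "lless P a d \<or> lless P d c"
proof (rule ccontr)
  assume n: "\<not> (lless P a d \<or> lless P d c)"
  note tr = lless_trans[OF P(1)]
  have car: "{a, b, c, d} \<subseteq> fst P" using lless_carrier[OF P(1)] assms(3-5) by blast
  have ac: "lless P a c" using tr assms(3,4) by blast
  have "a \<noteq> b" "a \<noteq> c" "a \<noteq> d" "b \<noteq> c" "b \<noteq> d" "c \<noteq> d"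
    using n ac assms(3,4) tr lless_irrefl[of P] by blast+
  then have dist: "distinct [a, b, c, d]" by simp
  have neg: "\<not> lless P a d" "\<not> lless P b a" "\<not> lless P b d" "\<not> lless P c a" "\<not> lless P c b"
    "\<not> lless P c d" "\<not> lless P d a" "\<not> lless P d b" "\<not> lless P d c"
    using n ac assms(3,4) tr lless_irrefl[of P] by blast+
  have "liso (induced P {a, b, c, d}) three_plus_one"
  proof (rule liso_via_four[OF P(1) car dist])
    fix i j :: nat assume "i < 4" "j < 4"
    then have "i \<in> {0, 1, 2, 3}" "j \<in> {0, 1, 2, 3}" by auto
    then show "(Suc i, Suc j) \<in> snd three_plus_one \<longleftrightarrow>
        i = j \<or> lless P ([a, b, c, d] ! i) ([a, b, c, d] ! j)"
      using neg ac assms(3,4) lless_irrefl[of P] by (elim insertE emptyE) (simp_all add: three_plus_one_def Id_on_iff)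
  qed (simp add: three_plus_one_def)
  then show False using P(2) car unfolding lsemiorder_def by blast
qed

text \<open>The rank is the position in a list sorted by \<open>k\<close>. Ties are broken
  arbitrarily, so \<open>r\<close> is a bijection even where \<open>k\<close> is not
  injective.\<close>

lemma exists_ranking:
  fixes k :: "'a \<Rightarrow> nat"
  assumes "finite A"
  obtains r where "bij_betw r A {..<card A}"
    "\<And>x y. x \<in> A \<Longrightarrow> y \<in> A \<Longrightarrow> r x \<le> r y \<Longrightarrow> k x \<le> k y"
proof -
  obtain xs where xs: "set xs = A" "distinct xs" using finite_distinct_list[OF assms] by blast
  define ys where "ys = sort_key k xs"
  have ys: "set ys = A" "distinct ys" "sorted (map k ys)" "length ys = card A"
    using xs distinct_card[of xs] by (auto simp: ys_def)
  have b: "bij_betw (\<lambda>i. ys ! i) {..<card A} A" using ys by (intro bij_betw_nth) auto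
  show ?thesis
  proof (rule that)
    let ?r = "inv_into {..<card A} (\<lambda>i. ys ! i)"
    show r: "bij_betw ?r A {..<card A}" by (rule bij_betw_inv_into[OF b])
    fix x y assume xy: "x \<in> A" "y \<in> A" "?r x \<le> ?r y"
    then have "?r y < length ys" using r ys(4) by (auto dest: bij_betwE)
    then have "k (ys ! ?r x) \<le> k (ys ! ?r y)"
      using sorted_nth_mono[OF ys(3) xy(3)] xy(3) by simp
    then show "k x \<le> k y" using bij_betw_inv_into_right[OF b] xy by simp
  qed
qed

text \<open>This converts closure of a set of ranks under smaller ranks into a comparison of a rank
  with a degree.\<close>

lemma initial_segment_eq_lessThan:
  fixes S :: "nat set"
  assumes "finite S" "\<And>i j. j \<in> S \<Longrightarrow> i \<le> j \<Longrightarrow> i \<in> S"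
  shows "S = {..<card S}"
proof (cases "S = {}")
  case False
  have "i \<in> S" if "i \<le> Max S" for i using assms(2) Max_in[OF assms(1) False] that by blast
  then have "S = {..Max S}" using assms(1) by auto
  moreover from this have "card S = Suc (Max S)" by (metis card_atMost)
  ultimately show ?thesis by (simp add: lessThan_Suc_atMost)
qed simp

text \<open>Sorting by \<open>d\<^sub>- - d\<^sub>+\<close> (shifted to stay in the naturals) makes every down-set an initial
  segment and every up-set a final segment.\<close>

lemma semiorder_ranking:
  assumes P: "finite_poset P" "lsemiorder P"
  defines "N \<equiv> card (fst P)"
  obtains r where "bij_betw r (fst P) {..<N}"
    "\<And>p q. p \<in> fst P \<Longrightarrow> q \<in> fst P \<Longrightarrow> lless P p q \<longleftrightarrow> r p < ldeg_minus P q"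
    "\<And>p q. p \<in> fst P \<Longrightarrow> q \<in> fst P \<Longrightarrow> lless P p q \<longleftrightarrow> N \<le> r q + ldeg_plus P p"
proof -
  define D where "D x = {y \<in> fst P. lless P y x}" for x
  define U where "U x = {y \<in> fst P. lless P x y}" for x
  have fin: "finite (fst P)" using P by (simp add: finite_poset_def)
  have finD: "finite (D x)" "finite (U x)" for x using fin by (simp_all add: D_def U_def)
  have dD: "ldeg_minus P x = card (D x)" "ldeg_plus P x = card (U x)" for x
    by (simp_all add: D_def U_def ldeg_minus_def ldeg_plus_def)
  have le: "ldeg_plus P x \<le> N" for x
    unfolding dD N_def U_def using fin by (intro card_mono) auto
  define k where "k x = card (D x) + (N - card (U x))" for x
  \<comment> \<open>Two incomparable down-sets would give points \<open>w < x\<close> and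
    \<open>z < y\<close> without cross relations, which is \<open>2+2\<close>. The same argument
    applies to up-sets.\<close>
  have nestD: "D x \<subseteq> D y \<or> D y \<subseteq> D x" for x y
    using semiorder_no_two_plus_two[OF P] unfolding D_def by blast
  have nestU: "U x \<subseteq> U y \<or> U y \<subseteq> U x" for x y
    using semiorder_no_two_plus_two[OF P] unfolding U_def by blast
  \<comment> \<open>Violating witnesses \<open>w\<close> and \<open>z\<close> form a chain
    \<open>w < y < z\<close> with neither \<open>w < x\<close> nor \<open>x < z\<close>,
    contradicting the exclusion of \<open>3+1\<close>.\<close>
  have key: "D y \<subseteq> D x \<or> U y \<subseteq> U x" if "x \<in> fst P" for x y
  proof (rule ccontr)
    assume "\<not> ?thesis"
    then obtain w z where "lless P w y" "\<not> lless P w x" "lless P y z" "\<not> lless P x z"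
      unfolding D_def U_def by blast
    then show False using semiorder_no_three_plus_one[OF P _ _ that] by blast
  qed
  have mono: "D x \<subseteq> D y \<and> U y \<subseteq> U x" if "x \<in> fst P" "y \<in> fst P" "k x \<le> k y" for x y
  proof (rule ccontr)
    assume n: "\<not> ?thesis"
    \<comment> \<open>If one inclusion fails, nesting reverses it strictly, and \<open>key\<close>
      then reverses the other one weakly. Both summands of \<open>k\<close> therefore move the wrong
      way, one of them strictly.\<close>
    have s: "D y \<subseteq> D x" "U x \<subseteq> U y" using n nestD nestU key[OF that(1), of y] key[OF that(2), of x]
      by blast+
    have "D y \<subset> D x \<or> U x \<subset> U y" using n s by blast
    then have "card (D y) < card (D x) \<or> card (U x) < card (U y)"
      using psubset_card_mono finD by metis
    moreover have "card (D y) \<le> card (D x)" "card (U x) \<le> card (U y)"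
      using s finD card_mono by metis+
    ultimately have "k y < k x" using le[of x] le[of y] unfolding k_def dD by linarith
    then show False using that by simp
  qed
  obtain r where r: "bij_betw r (fst P) {..<N}"
    and rk: "\<And>x y. x \<in> fst P \<Longrightarrow> y \<in> fst P \<Longrightarrow> r x \<le> r y \<Longrightarrow> k x \<le> k y"
    using exists_ranking[OF fin, of k] unfolding N_def by blast
  have inj: "inj_on r (fst P)" and img: "r ` fst P = {..<N}" using r by (auto simp: bij_betw_def)
  show ?thesis
  proof (rule that[OF r])
    fix p q assume pq: "p \<in> fst P" "q \<in> fst P"
    have "r ` D q = {..<card (r ` D q)}"
    proof (rule initial_segment_eq_lessThan)
      fix i j assume "j \<in> r ` D q" "i \<le> j"
      then obtain y where y: "y \<in> D q" "j = r y" by blast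
      then have "j < N" using img by (auto simp: D_def)
      then obtain x where x: "x \<in> fst P" "i = r x" using \<open>i \<le> j\<close> img
        by (metis image_iff lessThan_iff order.strict_trans1)
      \<comment> \<open>Up-sets shrink as the rank grows: from \<open>q\<close> in
        \<open>U y\<close> follows \<open>q\<close> in \<open>U x\<close>, so \<open>x\<close> lies
        below \<open>q\<close> as soon as \<open>y\<close> does.\<close>
      then have "U y \<subseteq> U x" using mono rk y \<open>i \<le> j\<close> by (auto simp: D_def)
      then have "x \<in> D q" using y x pq by (auto simp: D_def U_def)
      then show "i \<in> r ` D q" using x by blast
    qed (simp add: finD)
    also have "card (r ` D q) = card (D q)"
      using inj by (intro card_image) (auto simp: inj_on_def D_def)
    finally have "r ` D q = {..<card (D q)}" .
    moreover have "r p \<in> r ` D q \<longleftrightarrow> lless P p q"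
      using inj pq by (auto simp: D_def inj_on_def)
    ultimately show "lless P p q \<longleftrightarrow> r p < ldeg_minus P q" by (auto simp: dD)
    \<comment> \<open>The dual count uses the complement of the up-set, because it is the points not
      above \<open>p\<close> that occupy the lowest ranks.\<close>
    have "r ` (fst P - U p) = {..<card (r ` (fst P - U p))}"
    proof (rule initial_segment_eq_lessThan)
      fix i j assume "j \<in> r ` (fst P - U p)" "i \<le> j"
      then obtain y where y: "y \<in> fst P - U p" "j = r y" by blast
      then have "j < N" using img by auto
      then obtain x where x: "x \<in> fst P" "i = r x" using \<open>i \<le> j\<close> img
        by (metis image_iff lessThan_iff order.strict_trans1)
      then have "D x \<subseteq> D y" using mono rk y \<open>i \<le> j\<close> by auto
      then have "x \<in> fst P - U p" using y x pq by (auto simp: D_def U_def)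
      then show "i \<in> r ` (fst P - U p)" using x by blast
    qed (simp add: fin)
    also have "card (r ` (fst P - U p)) = card (fst P - U p)"
      using inj by (intro card_image) (auto simp: inj_on_def)
    also have "\<dots> = N - card (U p)"
      unfolding N_def by (intro card_Diff_subset finD) (auto simp: U_def)
    finally have "r ` (fst P - U p) = {..<N - card (U p)}" .
    moreover have "r q \<in> r ` (fst P - U p) \<longleftrightarrow> \<not> lless P p q"
      using inj pq by (auto simp: U_def inj_on_def)
    ultimately show "lless P p q \<longleftrightarrow> N \<le> r q + ldeg_plus P p" using le[of p] by (auto simp: dD)
  qed
qed

subsection \<open>Densities of kernels on the unit interval\<close>

abbreviation unit_lborel :: "real measure" where
  "unit_lborel \<equiv> restrict_space lborel {0..1}"

lemma prob_space_unit_lborel: "prob_space unit_lborel"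
  by (rule prob_spaceI) (simp add: space_restrict_space emeasure_restrict_space)

lemma product_prob_space_unit_lborel: "product_prob_space (\<lambda>_::'i. unit_lborel)"
  by (intro product_prob_spaceI prob_space_unit_lborel)

lemma AE_unit_lborel_not_in_countable:
  assumes "countable C"
  shows "AE x in unit_lborel. x \<notin> C"
proof -
  have "AE x in lborel. x \<notin> C" using assms by (intro AE_not_in countable_imp_null_set_lborel)
  then show ?thesis by (subst AE_restrict_space_iff) auto
qed

lemma component_unit_lborel_measurable:
  assumes "i \<in> I"
  shows "(\<lambda>x. x i) \<in> borel_measurable (\<Pi>\<^sub>M i\<in>I. unit_lborel)"
proof -
  have "(\<lambda>x. x) \<in> measurable unit_lborel borel" by (intro measurable_restrict_space1) simp
  from measurable_compose[OF measurable_component_singleton[OF assms] this] show ?thesis .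
qed

text \<open>Integrate over coordinate \<open>j\<close> first: with the other coordinates fixed, the
  exceptional set is a single point.\<close>

lemma AE_PiM_graph_null:
  fixes h :: "real \<Rightarrow> real"
  assumes "finite I" "i \<in> I" "j \<in> I" "i \<noteq> j" and [measurable]: "h \<in> borel_measurable borel"
  shows "AE x in (\<Pi>\<^sub>M i\<in>I. unit_lborel). h (x i) \<noteq> x j"
proof -
  interpret product_prob_space "\<lambda>_::'a. unit_lborel" by (rule product_prob_space_unit_lborel)
  define J where "J = I - {j}"
  have J: "finite J" "j \<notin> J" "insert j J = I" "i \<in> J" using assms by (auto simp: J_def)
  have [measurable]: "(\<lambda>x. x i) \<in> borel_measurable (\<Pi>\<^sub>M i\<in>I. unit_lborel)"
    "(\<lambda>x. x j) \<in> borel_measurable (\<Pi>\<^sub>M i\<in>I. unit_lborel)"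
    using assms component_unit_lborel_measurable by metis+
  define f :: "('a \<Rightarrow> real) \<Rightarrow> ennreal" where "f x = (if h (x i) = x j then 1 else 0)" for x
  have f: "f \<in> borel_measurable (\<Pi>\<^sub>M i\<in>I. unit_lborel)" unfolding f_def by measurable
  have z: "(\<integral>\<^sup>+ y. f (x(j := y)) \<partial>unit_lborel) = 0" for x
  proof -
    have "AE y in unit_lborel. y \<notin> {h (x i)}" by (intro AE_unit_lborel_not_in_countable) simp
    then have "(\<integral>\<^sup>+ y. f (x(j := y)) \<partial>unit_lborel) = (\<integral>\<^sup>+ y. 0 \<partial>unit_lborel)"
      by (intro nn_integral_cong_AE) (use assms(4) in \<open>auto simp: f_def\<close>)
    then show ?thesis by simp
  qed
  have "integral\<^sup>N (\<Pi>\<^sub>M i\<in>I. unit_lborel) f = 0"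
    using product_nn_integral_insert[OF J(1,2), of f] f z unfolding J(3) by simp
  then have "AE x in (\<Pi>\<^sub>M i\<in>I. unit_lborel). f x = 0" using f by (simp add: nn_integral_0_iff_AE)
  then show ?thesis by eventually_elim (auto simp: f_def split: if_splits)
qed

text \<open>Unlike \<^const>\<open>W_density\<close>, this allows kernels that are not of the form \<open>g x < y\<close>; the
  one coming from the up-degrees is \<open>x < h y\<close>.\<close>

definition kernel_density :: "(real \<Rightarrow> real \<Rightarrow> bool) \<Rightarrow> 'a lposet \<Rightarrow> real" where
  "kernel_density E Q = (LINT x | (\<Pi>\<^sub>M i\<in>fst Q. unit_lborel).
     of_bool (\<forall>i\<in>fst Q. \<forall>j\<in>fst Q. lless Q i j \<longrightarrow> E (x i) (x j)))"

lemma prod_indicator_eq_of_bool: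
  assumes "finite A"
  shows "(\<Prod>p\<in>A. if R p then 1 else 0 :: real) = of_bool (\<forall>p\<in>A. R p)"
proof (cases "\<forall>p\<in>A. R p")
  case False
  then show ?thesis using assms by (auto simp: prod_zero_iff)
qed simp

text \<open>The two inequalities need to agree only on the unit square, where the integral lives.
  Values of \<open>g\<close> outside the unit interval are thus irrelevant.\<close>

lemma W_density_eq_kernel_density:
  assumes "finite (fst Q)"
    and "\<And>x y. x \<in> {0..1} \<Longrightarrow> y \<in> {0..1} \<Longrightarrow> g x < y \<longleftrightarrow> E x y"
  shows "W_density g Q = kernel_density E Q"
  unfolding W_density_def kernel_density_def
proof (rule Bochner_Integration.integral_cong[OF refl])
  fix x assume "x \<in> space (\<Pi>\<^sub>M i\<in>fst Q. unit_lborel)"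
  then have x: "x i \<in> {0..1}" if "i \<in> fst Q" for i
    using that by (auto simp: space_PiM space_restrict_space PiE_iff)
  let ?A = "{(i, j). i \<in> fst Q \<and> j \<in> fst Q \<and> lless Q i j}"
  have "finite ?A" by (rule finite_subset[of _ "fst Q \<times> fst Q"]) (use assms(1) in auto)
  have "(\<Prod>(i, j)\<in>?A. W g (x i) (x j)) = (\<Prod>p\<in>?A. if E (x (fst p)) (x (snd p)) then 1 else 0)"
    using assms(2)[OF x x] by (intro prod.cong) (auto simp: W_def)
  also have "\<dots> = of_bool (\<forall>p\<in>?A. E (x (fst p)) (x (snd p)))"
    by (rule prod_indicator_eq_of_bool) fact
  also have "(\<forall>p\<in>?A. E (x (fst p)) (x (snd p))) \<longleftrightarrow>
      (\<forall>i\<in>fst Q. \<forall>j\<in>fst Q. lless Q i j \<longrightarrow> E (x i) (x j))" by auto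
  finally show "(\<Prod>(i, j)\<in>?A. W g (x i) (x j)) =
      of_bool (\<forall>i\<in>fst Q. \<forall>j\<in>fst Q. lless Q i j \<longrightarrow> E (x i) (x j))" .
qed

lemma kernel_integrand_measurable:
  fixes E :: "real \<Rightarrow> real \<Rightarrow> bool"
  assumes "finite (fst Q)" and E: "Measurable.pred (borel \<Otimes>\<^sub>M borel) (\<lambda>z. E (fst z) (snd z))"
  shows "(\<lambda>x. of_bool (\<forall>i\<in>fst Q. \<forall>j\<in>fst Q. lless Q i j \<longrightarrow> E (x i) (x j)) :: real)
    \<in> borel_measurable (\<Pi>\<^sub>M i\<in>fst Q. unit_lborel)"
proof -
  have 1: "Measurable.pred (\<Pi>\<^sub>M i\<in>fst Q. unit_lborel) (\<lambda>x. E (x i) (x j))"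
    if "i \<in> fst Q" "j \<in> fst Q" for i j
  proof -
    have "(\<lambda>x. (x i, x j)) \<in> measurable (\<Pi>\<^sub>M i\<in>fst Q. unit_lborel) (borel \<Otimes>\<^sub>M borel)"
      using that by (intro measurable_Pair component_unit_lborel_measurable)
    from measurable_compose[OF this E] show ?thesis by simp
  qed
  have "Measurable.pred (\<Pi>\<^sub>M i\<in>fst Q. unit_lborel)
      (\<lambda>x. \<forall>i\<in>fst Q. \<forall>j\<in>fst Q. lless Q i j \<longrightarrow> E (x i) (x j))"
    using assms(1) 1 by (intro pred_intros_finite pred_intros_imp') auto
  then show ?thesis by simp
qed

text \<open>Dominated convergence with bound 1. The integrands are 0 or 1 and involve finitely many
  pairs, so eventual agreement on each pair gives eventual equality. Diagonal pairs are exempt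
  because the strict order is irreflexive.\<close>

lemma kernel_density_tendsto:
  fixes E :: "nat \<Rightarrow> real \<Rightarrow> real \<Rightarrow> bool"
  assumes fin: "finite (fst Q)"
    and "\<And>n. Measurable.pred (borel \<Otimes>\<^sub>M borel) (\<lambda>z. E n (fst z) (snd z))"
    and "Measurable.pred (borel \<Otimes>\<^sub>M borel) (\<lambda>z. E' (fst z) (snd z))"
    and AE: "\<And>i j. i \<in> fst Q \<Longrightarrow> j \<in> fst Q \<Longrightarrow> i \<noteq> j \<Longrightarrow> AE x in (\<Pi>\<^sub>M i\<in>fst Q. unit_lborel).
      \<forall>\<^sub>F n in sequentially. E n (x i) (x j) \<longleftrightarrow> E' (x i) (x j)"
  shows "(\<lambda>n. kernel_density (E n) Q) \<longlonglongrightarrow> kernel_density E' Q"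
  unfolding kernel_density_def
proof (rule integral_dominated_convergence[where w = "\<lambda>_. 1"])
  let ?M = "\<Pi>\<^sub>M i\<in>fst Q. unit_lborel"
  interpret prob_space ?M by (rule prob_space_PiM) (rule prob_space_unit_lborel)
  show "integrable ?M (\<lambda>_. 1)" by simp
  have "AE x in ?M. \<forall>i\<in>fst Q. \<forall>j\<in>fst Q - {i}.
      \<forall>\<^sub>F n in sequentially. E n (x i) (x j) \<longleftrightarrow> E' (x i) (x j)"
    using fin AE by (intro AE_finite_allI) auto
  then show "AE x in ?M. (\<lambda>n. of_bool (\<forall>i\<in>fst Q. \<forall>j\<in>fst Q. lless Q i j \<longrightarrow> E n (x i) (x j)) :: real)
      \<longlonglongrightarrow> of_bool (\<forall>i\<in>fst Q. \<forall>j\<in>fst Q. lless Q i j \<longrightarrow> E' (x i) (x j))"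
  proof eventually_elim
    case (elim x)
    then have "\<forall>\<^sub>F n in sequentially. \<forall>i\<in>fst Q. \<forall>j\<in>fst Q - {i}. E n (x i) (x j) \<longleftrightarrow> E' (x i) (x j)"
      using fin by (intro eventually_ball_finite ballI) auto
    then have "\<forall>\<^sub>F n in sequentially.
        (of_bool (\<forall>i\<in>fst Q. \<forall>j\<in>fst Q. lless Q i j \<longrightarrow> E n (x i) (x j)) :: real) =
        of_bool (\<forall>i\<in>fst Q. \<forall>j\<in>fst Q. lless Q i j \<longrightarrow> E' (x i) (x j))"
    proof eventually_elim
      case (elim n)
      then have "(\<forall>i\<in>fst Q. \<forall>j\<in>fst Q. lless Q i j \<longrightarrow> E n (x i) (x j)) \<longleftrightarrow>
          (\<forall>i\<in>fst Q. \<forall>j\<in>fst Q. lless Q i j \<longrightarrow> E' (x i) (x j))"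
        unfolding lless_def by blast
      then show ?case by simp
    qed
    then show ?case by (rule tendsto_eventually)
  qed
qed (use assms in \<open>auto intro!: kernel_integrand_measurable simp del: measurable_of_bool\<close>)

text \<open>The rank intervals cut the unit cube, up to a null set, into boxes of volume
  \<open>(1 / N) ^ card (fst Q)\<close>, one for each map from \<open>Q\<close> to \<open>P\<close>.
  On the box of a map the integrand is constantly 1 or 0, according to whether the map is a
  homomorphism. The integral is therefore the proportion of homomorphisms, with no error
  term.\<close>

lemma hom_density_eq_kernel_density:
  fixes P :: "'a lposet" and Q :: "'b lposet"
  assumes P: "finite_poset P" and Q: "finite_poset Q"
  defines "N \<equiv> card (fst P)"
  assumes r: "bij_betw r (fst P) {..<N}"
    and E: "Measurable.pred (borel \<Otimes>\<^sub>M borel) (\<lambda>z. E (fst z) (snd z))"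
    and EP: "\<And>p q x y. p \<in> fst P \<Longrightarrow> q \<in> fst P \<Longrightarrow>
      r p < N * x \<Longrightarrow> N * x < real (r p) + 1 \<Longrightarrow> r q < N * y \<Longrightarrow> N * y < real (r q) + 1 \<Longrightarrow>
      E x y \<longleftrightarrow> lless P p q"
  shows "lhom_density Q P = kernel_density E Q"
proof -
  let ?M = "\<Pi>\<^sub>M i\<in>fst Q. unit_lborel"
  have fin: "finite (fst P)" "finite (fst Q)" "fst P \<noteq> {}"
    using P Q by (auto simp: finite_poset_def)
  interpret finite_product_prob_space "\<lambda>_::'b. unit_lborel" "fst Q"
    using Q by (intro finite_product_prob_space.intro finite_product_sigma_finite.intro
      finite_product_sigma_finite_axioms.intro product_prob_space_unit_lborel
      product_prob_space.axioms(1)) (simp add: finite_poset_def)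
  have N: "N > 0" using fin by (simp add: N_def card_gt_0_iff)
  define I where "I p = {r p / N <..< (real (r p) + 1) / N}" for p
  define B where "B \<phi> = (\<Pi>\<^sub>E q\<in>fst Q. I (\<phi> q))" for \<phi> :: "'b \<Rightarrow> 'a"
  have rN: "r p < N" if "p \<in> fst P" for p using r that by (auto dest: bij_betwE)
  have I01: "I p \<subseteq> {0..1}" if "p \<in> fst P" for p
  proof -
    have "(real (r p) + 1) / N \<le> 1" using rN[OF that] N by simp
    moreover have "0 \<le> real (r p) / N" by simp
    ultimately show ?thesis unfolding I_def by (meson atLeastAtMost_iff greaterThanLessThan_iff
      less_imp_le order_trans subsetI)
  qed
  have Iset: "I p \<in> sets unit_lborel" if "p \<in> fst P" for p
    using I01[OF that] unfolding sets_restrict_space by (auto simp: I_def image_iff intro!: bexI[of _ "I p"])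
  have Imeas: "measure unit_lborel (I p) = 1 / N" if "p \<in> fst P" for p
    using I01[OF that] N by (simp add: measure_restrict_space I_def add_divide_distrib)
  have IE: "x \<in> I p \<longleftrightarrow> r p < N * x \<and> N * x < real (r p) + 1" for p and x :: real
    using N by (auto simp: I_def field_simps)
  have BM: "B \<phi> \<in> sets ?M" "measure ?M (B \<phi>) = (1 / N) ^ card (fst Q)" if "\<phi> \<in> lhoms Q P" for \<phi>
  proof -
    have \<phi>: "\<phi> q \<in> fst P" if "q \<in> fst Q" for q using that \<open>\<phi> \<in> lhoms Q P\<close> by (auto simp: lhoms_def)
    show "B \<phi> \<in> sets ?M" unfolding B_def using Iset \<phi> fin by (intro sets_PiM_I_finite) auto
    show "measure ?M (B \<phi>) = (1 / N) ^ card (fst Q)" unfolding B_def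
      using Iset \<phi> Imeas by (subst prob_times) auto
  qed
  have finh: "finite (lhoms Q P)"
    using fin by (auto simp: lhoms_def finite_PiE)
  \<comment> \<open>Multiples of \<open>1 / N\<close> are discarded: the rank intervals are open,
    and nothing is assumed of \<open>E\<close> at their endpoints.\<close>
  have "AE x in ?M. \<forall>i\<in>fst Q. N * x i \<notin> \<int>"
  proof (intro AE_finite_allI fin)
    fix i assume "i \<in> fst Q"
    have "AE x in unit_lborel. x \<notin> (\<lambda>k. of_int k / N) ` UNIV"
      by (rule AE_unit_lborel_not_in_countable) simp
    then have "AE x in unit_lborel. N * x \<notin> \<int>"
      by eventually_elim (use N in \<open>auto simp: Ints_def field_simps image_iff\<close>)
    then show "AE x in ?M. N * x i \<notin> \<int>"
      using \<open>i \<in> fst Q\<close> prob_space_unit_lborel by (intro AE_PiM_component)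
  qed
  then have "AE x in ?M. of_bool (\<forall>i\<in>fst Q. \<forall>j\<in>fst Q. lless Q i j \<longrightarrow> E (x i) (x j)) =
      (\<Sum>\<phi>\<in>lhoms Q P. indicator (B \<phi>) x :: real)"
    using AE_space
  proof eventually_elim
    case (elim x)
    have x01: "x i \<in> {0..1}" if "i \<in> fst Q" for i
      using that elim(2) by (auto simp: space_PiM space_restrict_space PiE_iff)
    have "\<exists>p\<in>fst P. x i \<in> I p" if "i \<in> fst Q" for i
    proof -
      have n1: "N * x i \<noteq> of_int k" for k using elim(1) that by auto
      have "0 \<le> N * x i" "N * x i \<le> N" using x01[OF that] N by auto
      moreover have "N * x i \<noteq> real N" using n1[of "int N"] by simp
      ultimately have b: "0 \<le> N * x i" "N * x i < N" by auto
      define k where "k = nat \<lfloor>N * x i\<rfloor>"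
      have k: "real k \<le> N * x i" "N * x i < k + 1" using b unfolding k_def by linarith+
      moreover have "real k \<noteq> N * x i" using n1[of "int k"] by simp
      ultimately have k': "real k < N * x i" by simp
      have "k < N" using k b by linarith
      then obtain p where "p \<in> fst P" "k = r p" using r unfolding bij_betw_def by (metis imageE lessThan_iff)
      then show ?thesis using k' k by (auto simp: IE)
    qed
    then obtain \<psi> where \<psi>: "\<And>i. i \<in> fst Q \<Longrightarrow> \<psi> i \<in> fst P \<and> x i \<in> I (\<psi> i)" by metis
    define \<phi> where "\<phi> = restrict \<psi> (fst Q)"
    have \<phi>: "\<phi> \<in> fst Q \<rightarrow>\<^sub>E fst P" "\<And>i. i \<in> fst Q \<Longrightarrow> x i \<in> I (\<phi> i)" using \<psi> by (auto simp: \<phi>_def)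
    have uniq: "p = p'" if "y \<in> I p" "y \<in> I p'" "p \<in> fst P" "p' \<in> fst P" for y p p'
    proof -
      have "real (r p) < real (r p') + 1" "real (r p') < real (r p) + 1" using that(1,2) unfolding IE by linarith+
      then have "r p = r p'" by linarith
      then show ?thesis using that r by (auto simp: bij_betw_def inj_on_def)
    qed
    \<comment> \<open>The point \<open>x\<close> determines its map \<phi>, so at most one summand
      survives, and one does exactly when \<phi> is a homomorphism.\<close>
    have ind: "indicator (B \<phi>') x = (of_bool (\<phi>' = \<phi>) :: real)" if "\<phi>' \<in> lhoms Q P" for \<phi>'
    proof -
      have \<phi>': "\<phi>' \<in> fst Q \<rightarrow>\<^sub>E fst P" using that by (simp add: lhoms_def)
      have "x \<in> B \<phi>' \<longleftrightarrow> \<phi>' = \<phi>"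
      proof
        assume "x \<in> B \<phi>'"
        then have "x i \<in> I (\<phi>' i)" if "i \<in> fst Q" for i using that by (auto simp: B_def)
        then have "\<phi>' i = \<phi> i" if "i \<in> fst Q" for i
          using that uniq[of "x i" "\<phi>' i" "\<phi> i"] \<phi> \<phi>' by (auto simp: PiE_iff)
        then show "\<phi>' = \<phi>" using \<phi>(1) \<phi>' by (intro PiE_ext[of _ "fst Q"]) auto
      qed (use \<phi> elim(2) in \<open>auto simp: B_def space_PiM PiE_iff\<close>)
      then show ?thesis by (simp add: indicator_def)
    qed
    have "(\<forall>i\<in>fst Q. \<forall>j\<in>fst Q. lless Q i j \<longrightarrow> E (x i) (x j)) \<longleftrightarrow> \<phi> \<in> lhoms Q P"
    proof -
      have "E (x i) (x j) \<longleftrightarrow> lless P (\<phi> i) (\<phi> j)" if "i \<in> fst Q" "j \<in> fst Q" for i j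
        using EP[of "\<phi> i" "\<phi> j" "x i" "x j"] \<phi> that unfolding IE PiE_iff by blast
      then show ?thesis using \<phi>(1) by (simp add: lhoms_def)
    qed
    then show ?case using finh by (simp add: ind)
  qed
  then have "kernel_density E Q = (LINT x|?M. (\<Sum>\<phi>\<in>lhoms Q P. indicator (B \<phi>) x))"
    unfolding kernel_density_def
    using BM fin E by (intro integral_cong_AE kernel_integrand_measurable borel_measurable_sum) auto
  also have "\<dots> = (\<Sum>\<phi>\<in>lhoms Q P. (1 / N) ^ card (fst Q))"
    using BM by (subst Bochner_Integration.integral_sum) (auto intro!: sum.cong integrable_real_indicator simp: emeasure_eq_measure)
  also have "\<dots> = lhom_density Q P"
    using fin by (simp add: lhom_density_def card_PiE N_def power_divide)
  finally show ?thesis by simp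
qed

subsection \<open>Semiorders as kernels\<close>

lemma cdf_degree_distr:
  fixes d :: "'a \<Rightarrow> nat" and t :: real
  assumes "finite A" "A \<noteq> {}"
  shows "cdf (distr (measure_pmf (pmf_of_set A)) borel (\<lambda>x. real (d x) / real (card A))) t =
    card {x \<in> A. real (d x) \<le> card A * t} / card A"
proof -
  have N: "card A > 0" using assms by (simp add: card_gt_0_iff)
  have "A \<inter> (\<lambda>x. real (d x) / real (card A)) -` {..t} = {x \<in> A. real (d x) \<le> card A * t}"
    using N by (auto simp: field_simps)
  then show ?thesis using assms by (simp add: cdf_def measure_distr measure_pmf_of_set)
qed

lemma moment_degree_distr:
  fixes d :: "'a \<Rightarrow> nat"
  assumes "finite A" "A \<noteq> {}"
  shows "(LINT y|distr (measure_pmf (pmf_of_set A)) borel (\<lambda>x. real (d x) / real (card A)). y ^ k) =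
    (\<Sum>x\<in>A. real (d x) ^ k) / real (card A) ^ Suc k"
  using assms by (simp add: integral_distr integral_pmf_of_set power_divide sum_divide_distrib[symmetric])

lemma unit_distribution_degree_distr:
  fixes d :: "'a \<Rightarrow> nat"
  assumes "finite A" "A \<noteq> {}" "\<And>x. x \<in> A \<Longrightarrow> d x \<le> card A"
  shows "unit_distribution (distr (measure_pmf (pmf_of_set A)) borel (\<lambda>x. real (d x) / real (card A)))"
proof -
  have N: "card A > 0" using assms by (simp add: card_gt_0_iff)
  have "A \<inter> (\<lambda>x. real (d x) / real (card A)) -` {0..1} = A"
    using N assms(3) by auto
  then have "measure (distr (measure_pmf (pmf_of_set A)) borel (\<lambda>x. real (d x) / real (card A))) {0..1} = 1"
    using assms N by (simp add: measure_distr measure_pmf_of_set)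
  moreover have "real_distribution (distr (measure_pmf (pmf_of_set A)) borel (\<lambda>x. real (d x) / real (card A)))"
    by (intro prob_space.real_distribution_distr measure_pmf.prob_space_axioms) simp
  ultimately show ?thesis by (simp add: unit_distribution_def)
qed

lemma finite_posetD:
  assumes "finite_poset P"
  shows "finite (fst P)" "fst P \<noteq> {}" "card (fst P) > 0"
  using assms by (auto simp: finite_poset_def card_gt_0_iff)

lemma ldeg_le_card:
  assumes "finite_poset P"
  shows "ldeg_minus P x \<le> card (fst P)" "ldeg_plus P x \<le> card (fst P)"
  unfolding ldeg_minus_def ldeg_plus_def
  using finite_posetD[OF assms] by (auto intro!: card_mono)

lemma unit_distribution_lnu:
  assumes "finite_poset P"
  shows "unit_distribution (lnu_minus P)" "unit_distribution (lnu_plus P)"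
  unfolding lnu_minus_def lnu_plus_def
  using finite_posetD[OF assms] ldeg_le_card[OF assms]
  by (auto intro!: unit_distribution_degree_distr)

text \<open>For \<open>x\<close> in the open interval of \<open>p\<close>, the distribution function
  of the down-degrees counts the points not above \<open>p\<close>. Reflecting \<open>x\<close> to
  \<open>1 - x\<close> makes that of the up-degrees count the points not below
  \<open>p\<close>.\<close>

lemma semiorder_cdf:
  assumes P: "finite_poset P" "lsemiorder P"
  defines "N \<equiv> card (fst P)"
  obtains r where "bij_betw r (fst P) {..<N}"
    "\<And>p q. p \<in> fst P \<Longrightarrow> q \<in> fst P \<Longrightarrow> lless P p q \<longleftrightarrow> r p < ldeg_minus P q"
    "\<And>p q. p \<in> fst P \<Longrightarrow> q \<in> fst P \<Longrightarrow> lless P p q \<longleftrightarrow> N \<le> r q + ldeg_plus P p"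
    "\<And>p (x :: real). p \<in> fst P \<Longrightarrow> r p < N * x \<Longrightarrow> N * x < real (r p) + 1 \<Longrightarrow>
       N * cdf (lnu_minus P) x = N - real (ldeg_plus P p)"
    "\<And>p (x :: real). p \<in> fst P \<Longrightarrow> r p < N * x \<Longrightarrow> N * x < real (r p) + 1 \<Longrightarrow>
       N * cdf (lnu_plus P) (1 - x) = N - real (ldeg_minus P p)"
proof -
  note fin = finite_posetD[OF P(1)]
  obtain r where r: "bij_betw r (fst P) {..<N}"
    and rm: "\<And>p q. p \<in> fst P \<Longrightarrow> q \<in> fst P \<Longrightarrow> lless P p q \<longleftrightarrow> r p < ldeg_minus P q"
    and rp: "\<And>p q. p \<in> fst P \<Longrightarrow> q \<in> fst P \<Longrightarrow> lless P p q \<longleftrightarrow> N \<le> r q + ldeg_plus P p"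
    using semiorder_ranking[OF P] unfolding N_def by blast
  have N: "N > 0" using fin by (simp add: N_def)
  show ?thesis
  proof (rule that[OF r rm rp])
    fix p and x :: real assume p: "p \<in> fst P" and x: "r p < N * x" "N * x < real (r p) + 1"
    \<comment> \<open>The degree is an integer and \<open>N * x\<close> lies strictly between
      \<open>r p\<close> and \<open>r p + 1\<close>, so comparing with \<open>N * x\<close> is
      comparing with \<open>r p\<close>.\<close>
    have "real (ldeg_minus P q) \<le> N * x \<longleftrightarrow> \<not> lless P p q" if "q \<in> fst P" for q
      using rm[OF p that] x by linarith
    then have "{q \<in> fst P. real (ldeg_minus P q) \<le> N * x} = fst P - {q \<in> fst P. lless P p q}"
      by blast
    then have "card {q \<in> fst P. real (ldeg_minus P q) \<le> N * x} = N - ldeg_plus P p"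
      using fin by (simp add: card_Diff_subset N_def ldeg_plus_def)
    then show "N * cdf (lnu_minus P) x = N - real (ldeg_plus P p)"
      using cdf_degree_distr[OF fin(1,2), where d = "ldeg_minus P" and t = x] ldeg_le_card[OF P(1), of p] N
      unfolding lnu_minus_def N_def[symmetric] by (simp add: of_nat_diff)
    have "real (ldeg_plus P q) \<le> N * (1 - x) \<longleftrightarrow> \<not> lless P q p" if "q \<in> fst P" for q
      using rp[OF that p] x by (simp add: algebra_simps) linarith
    then have "{q \<in> fst P. real (ldeg_plus P q) \<le> N * (1 - x)} = fst P - {q \<in> fst P. lless P q p}"
      by blast
    then have "card {q \<in> fst P. real (ldeg_plus P q) \<le> N * (1 - x)} = N - ldeg_minus P p"
      using fin by (simp add: card_Diff_subset N_def ldeg_minus_def)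
    then show "N * cdf (lnu_plus P) (1 - x) = N - real (ldeg_minus P p)"
      using cdf_degree_distr[OF fin(1,2), where d = "ldeg_plus P" and t = "1 - x"] ldeg_le_card[OF P(1), of p] N
      unfolding lnu_plus_def N_def[symmetric] by (simp add: of_nat_diff)
  qed
qed

section \<open>Regularity and lower bounds of distribution functions\<close>

lemma mono_cdf: "real_distribution M \<Longrightarrow> mono (cdf M)"
  by (auto intro!: monoI finite_borel_measure.cdf_nondecreasing real_distribution.finite_borel_measure_M)

lemma borel_measurable_cdf: "real_distribution M \<Longrightarrow> cdf M \<in> borel_measurable borel"
  by (intro borel_measurable_mono mono_cdf)

lemma countable_cdf_discont: "real_distribution M \<Longrightarrow> countable {x. \<not> isCont (cdf M) x}"
  by (intro mono_ctble_discont mono_cdf)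

text \<open>Right continuity carries a lower bound leftwards to \<open>x\<close>. The set
  \<open>C\<close> holds the points where nothing is known, typically the discontinuities at which
  weak convergence is silent.\<close>

lemma cdf_ge_of_right_dense:
  assumes M: "real_distribution M" and C: "countable C" and "x < b"
    and le: "\<And>z. x < z \<Longrightarrow> z < b \<Longrightarrow> z \<notin> C \<Longrightarrow> c \<le> cdf M z"
  shows "c \<le> cdf M x"
proof (rule ccontr)
  interpret real_distribution M by fact
  assume "\<not> c \<le> cdf M x"
  moreover have "(cdf M \<longlongrightarrow> cdf M x) (at_right x)"
    using cdf_is_right_cont[of x] by (simp add: continuous_within)
  ultimately have "\<forall>\<^sub>F z in at_right x. cdf M z < c" by (intro order_tendstoD(2)) auto
  then obtain b' where b': "x < b'" "\<And>z. x < z \<Longrightarrow> z < b' \<Longrightarrow> cdf M z < c"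
    by (auto simp: eventually_at_right[of x b] assms(3))
  have "uncountable {x<..<min b b'}" using b'(1) assms(3) by (simp add: uncountable_open_interval)
  then obtain z where "z \<in> {x<..<min b b'}" "z \<notin> C" using C by (meson countable_subset subsetI)
  then show False using le[of z] b'(2)[of z] by auto
qed

lemma unit_distribution_cdf:
  assumes "unit_distribution M"
  shows "t < 0 \<Longrightarrow> cdf M t = 0" "1 \<le> t \<Longrightarrow> cdf M t = 1"
proof -
  interpret real_distribution M using assms by (simp add: unit_distribution_def)
  have 1: "prob {0..1} = 1" using assms by (simp add: unit_distribution_def)
  show "cdf M t = 0" if "t < 0"
  proof -
    have "prob ({..t} \<union> {0..1}) = prob {..t} + prob {0..1}"
      using that by (intro finite_measure_Union) auto
    then show ?thesis using 1 prob_le_1[of "{..t} \<union> {0..1}"] measure_nonneg[of M "{..t}"]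
      by (simp add: cdf_def)
  qed
  show "cdf M t = 1" if "1 \<le> t"
  proof -
    have "prob {0..1} \<le> prob {..t}" using that by (intro finite_measure_mono) auto
    then show ?thesis using 1 prob_le_1[of "{..t}"] by (simp add: cdf_def)
  qed
qed

text \<open>Irreflexivity is the source: since \<open>p\<close> is not below itself, its rank is
  less than \<open>N - ldeg_plus P p\<close>, and integrality gains the missing 1. Irrational
  \<open>x\<close> avoid the multiples of \<open>1 / N\<close> for all sizes at once. This bound is
  what makes the limiting functions admissible.\<close>

lemma semiorder_cdf_ge:
  assumes P: "finite_poset P" "lsemiorder P" and x: "0 < x" "x < 1" "x \<notin> \<rat>"
  shows "x \<le> cdf (lnu_minus P) x" "x \<le> cdf (lnu_plus P) x"
proof -
  define N where "N = card (fst P)"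
  have N: "N > 0" using finite_posetD[OF P(1)] by (simp add: N_def)
  obtain r where r: "bij_betw r (fst P) {..<N}"
    and rm: "\<And>p q. p \<in> fst P \<Longrightarrow> q \<in> fst P \<Longrightarrow> lless P p q \<longleftrightarrow> r p < ldeg_minus P q"
    and rp: "\<And>p q. p \<in> fst P \<Longrightarrow> q \<in> fst P \<Longrightarrow> lless P p q \<longleftrightarrow> N \<le> r q + ldeg_plus P p"
    and cm: "\<And>p (x :: real). p \<in> fst P \<Longrightarrow> r p < N * x \<Longrightarrow> N * x < real (r p) + 1 \<Longrightarrow>
       N * cdf (lnu_minus P) x = N - real (ldeg_plus P p)"
    and cp: "\<And>p (x :: real). p \<in> fst P \<Longrightarrow> r p < N * x \<Longrightarrow> N * x < real (r p) + 1 \<Longrightarrow>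
       N * cdf (lnu_plus P) (1 - x) = N - real (ldeg_minus P p)"
    using semiorder_cdf[OF P, folded N_def] by blast
  have ex: "\<exists>p\<in>fst P. r p < N * z \<and> N * z < real (r p) + 1" if z: "0 < z" "z < 1" "z \<notin> \<rat>" for z :: real
  proof -
    define k where "k = nat \<lfloor>N * z\<rfloor>"
    have b: "0 \<le> N * z" "N * z < N" using z N by auto
    have k: "real k \<le> N * z" "N * z < k + 1" using b unfolding k_def by linarith+
    have "real k \<noteq> N * z"
    proof
      assume "real k = N * z"
      then have "z = real k / real N" using N by (simp add: field_simps)
      then show False using z(3) by simp
    qed
    then have k': "real k < N * z" using k by simp
    have "k < N" using k b by linarith
    then obtain p where "p \<in> fst P" "k = r p" using r unfolding bij_betw_def by (metis imageE lessThan_iff)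
    then show ?thesis using k k' by auto
  qed
  obtain p where p: "p \<in> fst P" "r p < N * x" "N * x < real (r p) + 1" using ex x by blast
  have "\<not> N \<le> r p + ldeg_plus P p" using rp[OF p(1,1)] lless_irrefl[of P p] by simp
  then have "N * x \<le> N * cdf (lnu_minus P) x" using cm[OF p] p by linarith
  then show "x \<le> cdf (lnu_minus P) x" using N by simp
  have "1 - x \<notin> \<rat>" using x(3) Rats_diff[of 1 "1 - x"] by auto
  then obtain q where q: "q \<in> fst P" "r q < N * (1 - x)" "N * (1 - x) < real (r q) + 1"
    using ex[of "1 - x"] x by auto
  have "\<not> r q < ldeg_minus P q" using rm[OF q(1,1)] lless_irrefl[of P q] by simp
  moreover have "N * cdf (lnu_plus P) x = N - real (ldeg_minus P q)" using cp[OF q] by simp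
  ultimately have "N * x \<le> N * cdf (lnu_plus P) x" using q by (simp add: algebra_simps)
  then show "x \<le> cdf (lnu_plus P) x" using N by simp
qed

section \<open>Exact density formulas and their limits\<close>

lemma pred_kernel_minus:
  assumes [measurable]: "h \<in> borel_measurable borel"
  shows "Measurable.pred (borel \<Otimes>\<^sub>M borel) (\<lambda>z. h (fst z) < (snd z :: real))"
  by measurable

lemma pred_kernel_plus:
  assumes [measurable]: "h \<in> borel_measurable borel"
  shows "Measurable.pred (borel \<Otimes>\<^sub>M borel) (\<lambda>z :: real \<times> real. h (1 - snd z) < (1 - fst z :: real))"
  by measurable

text \<open>On the interval of \<open>p\<close> the scaled distribution function is
  \<open>N - ldeg_plus P p\<close>. Being an integer, it is below \<open>N * y\<close> iff it is at
  most the rank of \<open>q\<close>, which is the up-degree form of \<open>p < q\<close>.\<close>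

lemma semiorder_density_minus:
  assumes P: "finite_poset P" "lsemiorder P" and Q: "finite_poset Q"
  shows "lhom_density Q P = kernel_density (\<lambda>x y. cdf (lnu_minus P) x < y) Q"
proof -
  define N where "N = card (fst P)"
  have N: "N > 0" using finite_posetD[OF P(1)] by (simp add: N_def)
  have d: "real_distribution (lnu_minus P)" using unit_distribution_lnu[OF P(1)] by (simp add: unit_distribution_def)
  obtain r where r: "bij_betw r (fst P) {..<N}"
    and rm: "\<And>p q. p \<in> fst P \<Longrightarrow> q \<in> fst P \<Longrightarrow> lless P p q \<longleftrightarrow> r p < ldeg_minus P q"
    and rp: "\<And>p q. p \<in> fst P \<Longrightarrow> q \<in> fst P \<Longrightarrow> lless P p q \<longleftrightarrow> N \<le> r q + ldeg_plus P p"
    and cm: "\<And>p (x :: real). p \<in> fst P \<Longrightarrow> r p < N * x \<Longrightarrow> N * x < real (r p) + 1 \<Longrightarrow>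
       N * cdf (lnu_minus P) x = N - real (ldeg_plus P p)"
    and cp: "\<And>p (x :: real). p \<in> fst P \<Longrightarrow> r p < N * x \<Longrightarrow> N * x < real (r p) + 1 \<Longrightarrow>
       N * cdf (lnu_plus P) (1 - x) = N - real (ldeg_minus P p)"
    using semiorder_cdf[OF P, folded N_def] by blast
  show ?thesis
  proof (rule hom_density_eq_kernel_density[OF P(1) Q r[unfolded N_def]])
    show "Measurable.pred (borel \<Otimes>\<^sub>M borel) (\<lambda>z. cdf (lnu_minus P) (fst z) < snd z)"
      by (intro pred_kernel_minus borel_measurable_cdf d)
    fix p q and x y :: real
    assume p: "p \<in> fst P" and q: "q \<in> fst P" and "r p < card (fst P) * x" "card (fst P) * x < real (r p) + 1"
      and y: "r q < card (fst P) * y" "card (fst P) * y < real (r q) + 1"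
    then have c: "N * cdf (lnu_minus P) x = N - real (ldeg_plus P p)" by (intro cm) (auto simp: N_def)
    have "cdf (lnu_minus P) x < y \<longleftrightarrow> N * cdf (lnu_minus P) x < N * y" using N by simp
    also have "\<dots> \<longleftrightarrow> N \<le> r q + ldeg_plus P p" using y unfolding c N_def[symmetric] by linarith
    finally show "cdf (lnu_minus P) x < y \<longleftrightarrow> lless P p q" using rp[OF p q] by simp
  qed
qed

text \<open>Here the distribution function is evaluated at the upper point \<open>q\<close>, giving
  \<open>N - ldeg_minus P q\<close>, and the down-degree form of \<open>p < q\<close> is
  used.\<close>

lemma semiorder_density_plus:
  assumes P: "finite_poset P" "lsemiorder P" and Q: "finite_poset Q"
  shows "lhom_density Q P = kernel_density (\<lambda>x y. cdf (lnu_plus P) (1 - y) < 1 - x) Q"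
proof -
  define N where "N = card (fst P)"
  have N: "N > 0" using finite_posetD[OF P(1)] by (simp add: N_def)
  have d: "real_distribution (lnu_plus P)" using unit_distribution_lnu[OF P(1)] by (simp add: unit_distribution_def)
  obtain r where r: "bij_betw r (fst P) {..<N}"
    and rm: "\<And>p q. p \<in> fst P \<Longrightarrow> q \<in> fst P \<Longrightarrow> lless P p q \<longleftrightarrow> r p < ldeg_minus P q"
    and rp: "\<And>p q. p \<in> fst P \<Longrightarrow> q \<in> fst P \<Longrightarrow> lless P p q \<longleftrightarrow> N \<le> r q + ldeg_plus P p"
    and cm: "\<And>p (x :: real). p \<in> fst P \<Longrightarrow> r p < N * x \<Longrightarrow> N * x < real (r p) + 1 \<Longrightarrow>
       N * cdf (lnu_minus P) x = N - real (ldeg_plus P p)"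
    and cp: "\<And>p (x :: real). p \<in> fst P \<Longrightarrow> r p < N * x \<Longrightarrow> N * x < real (r p) + 1 \<Longrightarrow>
       N * cdf (lnu_plus P) (1 - x) = N - real (ldeg_minus P p)"
    using semiorder_cdf[OF P, folded N_def] by blast
  show ?thesis
  proof (rule hom_density_eq_kernel_density[OF P(1) Q r[unfolded N_def]])
    show "Measurable.pred (borel \<Otimes>\<^sub>M borel) (\<lambda>z. cdf (lnu_plus P) (1 - snd z) < 1 - fst z)"
      by (intro pred_kernel_plus borel_measurable_cdf d)
    fix p q and x y :: real
    assume p: "p \<in> fst P" and q: "q \<in> fst P" and x: "r p < card (fst P) * x" "card (fst P) * x < real (r p) + 1"
      and "r q < card (fst P) * y" "card (fst P) * y < real (r q) + 1"
    then have c: "N * cdf (lnu_plus P) (1 - y) = N - real (ldeg_minus P q)" by (intro cp) (auto simp: N_def)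
    have "cdf (lnu_plus P) (1 - y) < 1 - x \<longleftrightarrow> N * cdf (lnu_plus P) (1 - y) < N * (1 - x)" using N by simp
    also have "\<dots> \<longleftrightarrow> N * x < ldeg_minus P q" unfolding c by (simp add: algebra_simps)
    also have "\<dots> \<longleftrightarrow> r p < ldeg_minus P q" using x unfolding N_def[symmetric] by linarith
    finally show "cdf (lnu_plus P) (1 - y) < 1 - x \<longleftrightarrow> lless P p q" using rm[OF p q] by simp
  qed
qed

lemma eventually_less_iff:
  fixes a :: "nat \<Rightarrow> real"
  assumes "a \<longlonglongrightarrow> l" "l \<noteq> c"
  shows "\<forall>\<^sub>F n in sequentially. a n < c \<longleftrightarrow> l < c"
proof (cases "l < c")
  case True
  then show ?thesis using order_tendstoD(2)[OF assms(1) True] by (auto elim: eventually_mono)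
next
  case False
  then have "c < l" using assms(2) by simp
  from order_tendstoD(1)[OF assms(1) this] False show ?thesis by (auto elim: eventually_mono)
qed

text \<open>Two null sets are removed: discontinuities of the limit, where values need not converge,
  and the graph where \<open>cdf \<nu> (x i) = x j\<close>, where a strict inequality need not
  stabilise.\<close>

lemma semiorder_density_tendsto_minus:
  assumes P: "\<And>n. finite_poset (P n)" "\<And>n. lsemiorder (P n)" and Q: "finite_poset Q"
    and \<nu>: "real_distribution \<nu>" "weak_conv_m (\<lambda>n. lnu_minus (P n)) \<nu>"
  shows "(\<lambda>n. lhom_density Q (P n)) \<longlonglongrightarrow> kernel_density (\<lambda>x y. cdf \<nu> x < y) Q"
proof -
  have d: "real_distribution (lnu_minus (P n))" for n
    using unit_distribution_lnu[OF P(1)] by (simp add: unit_distribution_def)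
  have fin: "finite (fst Q)" using Q by (simp add: finite_poset_def)
  show ?thesis unfolding semiorder_density_minus[OF P Q]
  proof (rule kernel_density_tendsto[OF fin])
    fix i j assume ij: "i \<in> fst Q" "j \<in> fst Q" "i \<noteq> j"
    have "AE x in unit_lborel. isCont (cdf \<nu>) x"
      using AE_unit_lborel_not_in_countable[OF countable_cdf_discont[OF \<nu>(1)]] by simp
    then have "AE x in (\<Pi>\<^sub>M i\<in>fst Q. unit_lborel). isCont (cdf \<nu>) (x i)"
      using ij prob_space_unit_lborel by (intro AE_PiM_component)
    moreover have "AE x in (\<Pi>\<^sub>M i\<in>fst Q. unit_lborel). cdf \<nu> (x i) \<noteq> x j"
      by (intro AE_PiM_graph_null fin ij borel_measurable_cdf \<nu>)
    ultimately show "AE x in (\<Pi>\<^sub>M i\<in>fst Q. unit_lborel). \<forall>\<^sub>F n in sequentially.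
        cdf (lnu_minus (P n)) (x i) < x j \<longleftrightarrow> cdf \<nu> (x i) < x j"
    proof eventually_elim
      case (elim x)
      then show ?case using \<nu>(2) unfolding weak_conv_m_def weak_conv_def
        by (intro eventually_less_iff) auto
    qed
  qed (intro pred_kernel_minus borel_measurable_cdf d \<nu>)+
qed

text \<open>As for down-degrees, with the discontinuities reflected by \<open>1 - x\<close> and the
  null graph taken over coordinate \<open>j\<close>.\<close>

lemma semiorder_density_tendsto_plus:
  assumes P: "\<And>n. finite_poset (P n)" "\<And>n. lsemiorder (P n)" and Q: "finite_poset Q"
    and \<nu>: "real_distribution \<nu>" "weak_conv_m (\<lambda>n. lnu_plus (P n)) \<nu>"
  shows "(\<lambda>n. lhom_density Q (P n)) \<longlonglongrightarrow> kernel_density (\<lambda>x y. cdf \<nu> (1 - y) < 1 - x) Q"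
proof -
  have d: "real_distribution (lnu_plus (P n))" for n
    using unit_distribution_lnu[OF P(1)] by (simp add: unit_distribution_def)
  have fin: "finite (fst Q)" using Q by (simp add: finite_poset_def)
  have [measurable]: "cdf \<nu> \<in> borel_measurable borel" by (intro borel_measurable_cdf \<nu>)
  show ?thesis unfolding semiorder_density_plus[OF P Q]
  proof (rule kernel_density_tendsto[OF fin])
    fix i j assume ij: "i \<in> fst Q" "j \<in> fst Q" "i \<noteq> j"
    have "AE x in unit_lborel. x \<notin> (\<lambda>x. 1 - x) ` {x. \<not> isCont (cdf \<nu>) x}"
      by (intro AE_unit_lborel_not_in_countable countable_image countable_cdf_discont \<nu>)
    then have "AE x in unit_lborel. isCont (cdf \<nu>) (1 - x)"
      by eventually_elim (force simp: image_iff)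
    then have "AE x in (\<Pi>\<^sub>M i\<in>fst Q. unit_lborel). isCont (cdf \<nu>) (1 - x j)"
      using ij(2) prob_space_unit_lborel by (intro AE_PiM_component[of _ _ j "\<lambda>x. isCont (cdf \<nu>) (1 - x)"])
    moreover have "AE x in (\<Pi>\<^sub>M i\<in>fst Q. unit_lborel). 1 - cdf \<nu> (1 - x j) \<noteq> x i"
      using ij by (intro AE_PiM_graph_null[where h = "\<lambda>z. 1 - cdf \<nu> (1 - z)"] fin) auto
    ultimately show "AE x in (\<Pi>\<^sub>M i\<in>fst Q. unit_lborel). \<forall>\<^sub>F n in sequentially.
        cdf (lnu_plus (P n)) (1 - x j) < 1 - x i \<longleftrightarrow> cdf \<nu> (1 - x j) < 1 - x i"
    proof eventually_elim
      case (elim x)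
      then show ?case using \<nu>(2) unfolding weak_conv_m_def weak_conv_def
        by (intro eventually_less_iff) auto
    qed
  qed (intro pred_kernel_plus borel_measurable_cdf d \<nu>)+
qed

subsection \<open>Convergence of the degree distributions\<close>

text \<open>Continuity points are dense, so the values 0 left of the unit interval and 1 right of it
  pass to the limit; right continuity then settles the endpoint 1.\<close>

lemma unit_distribution_weak_limit:
  assumes u: "\<And>n. unit_distribution (\<mu> n)" and M: "real_distribution M" and conv: "weak_conv_m \<mu> M"
  shows "unit_distribution M"
proof -
  interpret real_distribution M by fact
  let ?C = "{x. \<not> isCont (cdf M) x}"
  have C: "countable ?C" by (rule countable_cdf_discont[OF M])
  have lim: "(\<lambda>n. cdf (\<mu> n) z) \<longlonglongrightarrow> cdf M z" if "z \<notin> ?C" for z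
    using conv that by (auto simp: weak_conv_m_def weak_conv_def)
  have neg: "cdf M t = 0" if t: "t < 0" for t
  proof -
    obtain z where z: "t < z" "z < 0" "z \<notin> ?C"
    proof -
      have "uncountable {t<..<0}" using t by (simp add: uncountable_open_interval)
      then show ?thesis using C that by (meson countable_subset greaterThanLessThan_iff subsetI)
    qed
    then have "cdf M z = 0" using lim[of z] unit_distribution_cdf(1)[OF u]
      by (auto intro: LIMSEQ_unique)
    then show ?thesis using cdf_nondecreasing[of t z] cdf_nonneg[of t] z by simp
  qed
  have "1 \<le> cdf M 1"
  proof (rule cdf_ge_of_right_dense[OF M C, where b = 2])
    fix z :: real assume "1 < z" "z \<notin> ?C"
    then show "1 \<le> cdf M z" using lim[of z] unit_distribution_cdf(2)[OF u, of z]
      by (auto intro!: LIMSEQ_le_const[of _ "cdf M z"])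
  qed simp
  then have one: "prob {..1} = 1" using prob_le_1 by (intro antisym) (simp_all add: cdf_def)
  \<comment> \<open>The left limit at 0 is used, not \<open>cdf M 0\<close>, since the limit may
    have an atom at 0.\<close>
  have "(cdf M \<longlongrightarrow> 0) (at_left 0)"
    by (intro tendsto_eventually eventually_at_leftI[of "-1"]) (auto simp: neg)
  then have "prob {..<0} = 0" using cdf_at_left[of 0] by (auto intro: tendsto_unique[of "at_left (0::real)"])
  moreover have "prob ({..1} - {..<0}) = prob {..1} - prob {..<0}"
    by (intro finite_measure_Diff) auto
  moreover have "{..1} - {..<0} = {0..1::real}" by auto
  ultimately show ?thesis using one M by (simp add: unit_distribution_def)
qed

section \<open>The method of moments on the unit interval\<close>

lemma unit_distribution_AE:
  assumes "unit_distribution M"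
  shows "AE x in M. x \<in> {0..1}"
proof -
  interpret real_distribution M using assms by (simp add: unit_distribution_def)
  show ?thesis using assms by (subst AE_in_set_eq_1) (auto simp: unit_distribution_def)
qed

lemma unit_distribution_moment_integrable:
  assumes "unit_distribution M"
  shows "integrable M (\<lambda>x. x ^ k)"
proof -
  interpret real_distribution M using assms by (simp add: unit_distribution_def)
  show ?thesis
  proof (rule integrable_const_bound[where B = 1])
    show "AE x in M. norm (x ^ k) \<le> 1" using unit_distribution_AE[OF assms]
      by eventually_elim (auto simp: power_abs power_le_one)
  qed simp
qed

text \<open>Absolute moments on the unit interval are at most 1, so the Taylor error depends only on
  \<open>t\<close> and \<open>m\<close>, uniformly over all such distributions.\<close>

lemma unit_distribution_char_approx:
  assumes "unit_distribution M"
  shows "cmod (char M t - (\<Sum>k\<le>m. ((\<i> * t) ^ k / fact k) * (LINT x|M. x ^ k))) \<le> 2 * (\<bar>t\<bar> ^ m / fact m)"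
proof -
  interpret real_distribution M using assms by (simp add: unit_distribution_def)
  have "expectation (\<lambda>x. \<bar>x\<bar> ^ m) \<le> expectation (\<lambda>_. 1)"
  proof (rule integral_mono_AE)
    show "integrable M (\<lambda>x. \<bar>x\<bar> ^ m)"
      using integrable_abs[OF unit_distribution_moment_integrable[OF assms, of m]] by (simp add: power_abs)
    show "AE x in M. \<bar>x\<bar> ^ m \<le> 1" using unit_distribution_AE[OF assms]
      by eventually_elim (auto simp: power_le_one)
  qed simp
  then have e: "expectation (\<lambda>x. \<bar>x\<bar> ^ m) \<le> 1" using prob_space by simp
  have "cmod (char M t - (\<Sum>k\<le>m. ((\<i> * t) ^ k / fact k) * (LINT x|M. x ^ k))) \<le>
      (2 * \<bar>t\<bar> ^ m / fact m) * expectation (\<lambda>x. \<bar>x\<bar> ^ m)"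
    by (rule char_approx1) (rule unit_distribution_moment_integrable[OF assms])
  also have "\<dots> \<le> (2 * \<bar>t\<bar> ^ m / fact m) * 1" using e by (intro mult_left_mono) auto
  finally show ?thesis by simp
qed

text \<open>A three-epsilon argument: each Taylor polynomial is a finite combination of convergent
  moments, and the truncation error is uniform in \<open>n\<close>.\<close>

lemma convergent_char_of_moments:
  assumes u: "\<And>n. unit_distribution (\<mu> n)" and m: "\<And>k. convergent (\<lambda>n. LINT x|\<mu> n. x ^ k)"
  shows "convergent (\<lambda>n. char (\<mu> n) t)"
proof -
  define S where "S m n = (\<Sum>k\<le>m. ((\<i> * t) ^ k / fact k) * (LINT x|\<mu> n. x ^ k))" for m n
  have "convergent (S m)" for m
  proof -
    have "(\<lambda>n. S m n) \<longlonglongrightarrow> (\<Sum>k\<le>m. ((\<i> * t) ^ k / fact k) * of_real (lim (\<lambda>n. LINT x|\<mu> n. x ^ k)))"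
      unfolding S_def using m by (intro tendsto_intros) (simp add: convergent_LIMSEQ_iff)
    then show ?thesis by (auto simp: convergent_def)
  qed
  then have S: "Cauchy (S m)" for m by (simp add: Cauchy_convergent_iff)
  have "Cauchy (\<lambda>n. char (\<mu> n) t)"
  proof (rule metric_CauchyI)
    fix e :: real assume e: "e > 0"
    have "(\<lambda>m. 2 * (\<bar>t\<bar> ^ m / fact m)) \<longlonglongrightarrow> 2 * 0"
      using summable_LIMSEQ_zero[OF summable_exp[of "\<bar>t\<bar>"]]
      by (intro tendsto_intros) (simp add: divide_inverse mult.commute)
    then have "\<forall>\<^sub>F m in sequentially. 2 * (\<bar>t\<bar> ^ m / fact m) < e / 3"
      using e by (intro order_tendstoD(2)) auto
    then obtain m where m: "2 * (\<bar>t\<bar> ^ m / fact m) < e / 3" by (auto simp: eventually_sequentially)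
    have a: "dist (char (\<mu> n) t) (S m n) < e / 3" for n
      using unit_distribution_char_approx[OF u, of n t m] m by (simp add: dist_norm S_def)
    obtain N where N: "\<And>i j. i \<ge> N \<Longrightarrow> j \<ge> N \<Longrightarrow> dist (S m i) (S m j) < e / 3"
      using metric_CauchyD[OF S, of "e / 3" m] e by auto
    show "\<exists>N. \<forall>i\<ge>N. \<forall>j\<ge>N. dist (char (\<mu> i) t) (char (\<mu> j) t) < e"
    proof (intro exI allI impI)
      fix i j assume "i \<ge> N" "j \<ge> N"
      then show "dist (char (\<mu> i) t) (char (\<mu> j) t) < e"
        using N[of i j] a[of i] a[of j]
          dist_triangle[of "char (\<mu> i) t" "char (\<mu> j) t" "S m i"]
          dist_triangle[of "S m i" "char (\<mu> j) t" "S m j"]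
        by (simp add: dist_commute)
    qed
  qed
  then show ?thesis by (simp add: Cauchy_convergent_iff)
qed

text \<open>Common support in the unit interval gives tightness. All subsequential limits share the
  limiting characteristic function, so they coincide and the whole sequence converges.\<close>

lemma weak_conv_of_moments:
  assumes u: "\<And>n. unit_distribution (\<mu> n)" and m: "\<And>k. convergent (\<lambda>n. LINT x|\<mu> n. x ^ k)"
  shows "\<exists>\<nu>. unit_distribution \<nu> \<and> weak_conv_m \<mu> \<nu>"
proof -
  have d: "real_distribution (\<mu> n)" for n using u by (simp add: unit_distribution_def)
  have "tight \<mu>" unfolding tight_def
  proof (intro conjI allI impI d)
    fix \<epsilon> :: real assume "\<epsilon> > 0"
    \<comment> \<open>The half-open interval starts at -1 so that it contains a possible atom at
      0.\<close>
    have "1 - \<epsilon> < measure (\<mu> n) {-1<..1}" for n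
    proof -
      interpret real_distribution "\<mu> n" by (rule d)
      have "prob {0..1} \<le> prob {-1<..1}" by (intro finite_measure_mono) auto
      then show ?thesis using u[of n] \<open>\<epsilon> > 0\<close> by (simp add: unit_distribution_def)
    qed
    then show "\<exists>a b. a < b \<and> (\<forall>n. 1 - \<epsilon> < measure (\<mu> n) {a<..b})"
      by (intro exI[of _ "-1"] exI[of _ 1]) auto
  qed
  have chr: "char \<nu> t = lim (\<lambda>n. char (\<mu> n) t)"
    if s: "strict_mono s" "real_distribution \<nu>" "weak_conv_m (\<mu> \<circ> s) \<nu>" for s \<nu> t
  proof -
    have "(\<lambda>n. char ((\<mu> \<circ> s) n) t) \<longlonglongrightarrow> char \<nu> t"
      by (rule levy_continuity1[OF _ s(2,3)]) (simp add: d)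
    moreover have "(\<lambda>n. char (\<mu> n) t) \<longlonglongrightarrow> lim (\<lambda>n. char (\<mu> n) t)"
      using convergent_char_of_moments[OF u m] by (simp add: convergent_LIMSEQ_iff)
    then have "(\<lambda>n. char ((\<mu> \<circ> s) n) t) \<longlonglongrightarrow> lim (\<lambda>n. char (\<mu> n) t)"
      using LIMSEQ_subseq_LIMSEQ[OF _ s(1)] by (simp add: comp_def)
    ultimately show ?thesis by (rule LIMSEQ_unique)
  qed
  obtain s \<nu> where s: "strict_mono s" "real_distribution \<nu>" "weak_conv_m (\<mu> \<circ> s) \<nu>"
    using tight_imp_convergent_subsubsequence[OF \<open>tight \<mu>\<close> strict_mono_id] by auto
  have "weak_conv_m \<mu> \<nu>"
  proof (rule tight_subseq_weak_converge[OF d s(2) \<open>tight \<mu>\<close>])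
    fix s' \<nu>' assume s': "strict_mono s'" "real_distribution \<nu>'" "weak_conv_m (\<mu> \<circ> s') \<nu>'"
    have "\<nu>' = \<nu>" using s(2) s'(2) chr[OF s] chr[OF s'] by (intro Levy_uniqueness) auto
    then show "weak_conv_m (\<mu> \<circ> s') \<nu>" using s' by simp
  qed
  then show ?thesis using unit_distribution_weak_limit[of \<mu>, OF u s(2)] by blast
qed

section \<open>Star posets, whose densities are degree moments\<close>

definition star :: "nat \<Rightarrow> nat lposet" where
  "star k = ({..k}, Id_on {..k} \<union> {1..k} \<times> {0})"

definition costar :: "nat \<Rightarrow> nat lposet" where
  "costar k = ({..k}, Id_on {..k} \<union> {0} \<times> {1..k})"

lemma finite_poset_star: "finite_poset (star k)" "finite_poset (costar k)"
  by (auto simp: star_def costar_def finite_poset_def partial_order_on_def preorder_on_def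
      refl_on_def trans_def antisym_def)

text \<open>Sort the maps by the image \<open>q\<close> of the centre 0: the fibre over
  \<open>q\<close> is a product in which each of the \<open>k\<close> leaves ranges freely over
  \<open>D q\<close>.\<close>

lemma card_star_maps:
  assumes "finite A" "\<And>q. q \<in> A \<Longrightarrow> D q \<subseteq> A"
  shows "card {\<phi> \<in> {..k} \<rightarrow>\<^sub>E A. \<forall>i\<in>{1..k::nat}. \<phi> i \<in> D (\<phi> 0)} = (\<Sum>q\<in>A. card (D q) ^ k)"
proof -
  define S where "S q = (\<Pi>\<^sub>E i\<in>{..k}. if i = 0 then {q} else D q)" for q
  have finD: "finite (D q)" if "q \<in> A" for q using assms that finite_subset by blast
  have eq: "{\<phi> \<in> {..k} \<rightarrow>\<^sub>E A. \<forall>i\<in>{1..k}. \<phi> i \<in> D (\<phi> 0)} = (\<Union>q\<in>A. S q)" (is "?L = ?R")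
  proof (rule set_eqI)
    fix \<phi>
    have *: "\<phi> \<in> S q \<longleftrightarrow> \<phi> \<in> extensional {..k} \<and> \<phi> 0 = q \<and> (\<forall>i\<in>{1..k}. \<phi> i \<in> D q)" for q
      by (force simp: S_def PiE_iff)
    show "\<phi> \<in> ?L \<longleftrightarrow> \<phi> \<in> ?R"
    proof
      assume "\<phi> \<in> ?L"
      then show "\<phi> \<in> ?R" using * by (auto simp: PiE_iff)
    next
      assume "\<phi> \<in> ?R"
      then obtain q where q: "q \<in> A" "\<phi> \<in> extensional {..k}" "\<phi> 0 = q" "\<forall>i\<in>{1..k}. \<phi> i \<in> D q"
        using * by blast
      have "\<phi> i \<in> A" if "i \<le> k" for i
        using q assms(2)[of q] that by (cases "i = 0") auto
      then show "\<phi> \<in> ?L" using q by (auto simp: PiE_iff)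
    qed
  qed
  have "card (\<Union>q\<in>A. S q) = (\<Sum>q\<in>A. card (S q))"
  proof (rule card_UN_disjoint[OF assms(1)])
    show "\<forall>q\<in>A. finite (S q)" using finD by (auto simp: S_def intro!: finite_PiE)
    show "\<forall>p\<in>A. \<forall>q\<in>A. p \<noteq> q \<longrightarrow> S p \<inter> S q = {}"
      unfolding S_def by (force simp: PiE_iff)
  qed
  also have "\<dots> = (\<Sum>q\<in>A. card (D q) ^ k)"
  proof (rule sum.cong[OF refl])
    fix q
    have "card (S q) = (\<Prod>i\<in>{..k}. card (if i = 0 then {q} else D q))"
      unfolding S_def by (rule card_PiE) simp
    also have "{..k} = insert 0 {1..k}" by auto
    also have "(\<Prod>i\<in>insert 0 {1..k}. card (if i = 0 then {q} else D q)) = card (D q) ^ k" by simp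
    finally show "card (S q) = card (D q) ^ k" .
  qed
  finally show ?thesis unfolding eq .
qed

text \<open>The normalisations match: of the \<open>k + 1\<close> factors of the poset size,
  \<open>k\<close> come from rescaling degrees and one from averaging over a uniform point.\<close>

lemma lhom_density_star:
  assumes P: "finite_poset P"
  shows "lhom_density (star k) P = (LINT x|lnu_minus P. x ^ k)"
    and "lhom_density (costar k) P = (LINT x|lnu_plus P. x ^ k)"
proof -
  note fin = finite_posetD[OF P]
  have "lhoms (star k) P = {\<phi> \<in> {..k} \<rightarrow>\<^sub>E fst P. \<forall>i\<in>{1..k}. \<phi> i \<in> {y \<in> fst P. lless P y (\<phi> 0)}}"
    by (auto simp: lhoms_def star_def lless_def[of "({..k}, _)"])
  then have "card (lhoms (star k) P) = (\<Sum>q\<in>fst P. ldeg_minus P q ^ k)"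
    unfolding ldeg_minus_def using card_star_maps[OF fin(1), of "\<lambda>q. {y \<in> fst P. lless P y q}" k] by simp
  then show "lhom_density (star k) P = (LINT x|lnu_minus P. x ^ k)"
    unfolding lnu_minus_def moment_degree_distr[OF fin(1,2)] lhom_density_def
    by (simp add: star_def card_PiE)
  have "lhoms (costar k) P = {\<phi> \<in> {..k} \<rightarrow>\<^sub>E fst P. \<forall>i\<in>{1..k}. \<phi> i \<in> {y \<in> fst P. lless P (\<phi> 0) y}}"
    by (auto simp: lhoms_def costar_def lless_def[of "({..k}, _)"])
  then have "card (lhoms (costar k) P) = (\<Sum>q\<in>fst P. ldeg_plus P q ^ k)"
    unfolding ldeg_plus_def using card_star_maps[OF fin(1), of "\<lambda>q. {y \<in> fst P. lless P q y}" k] by simp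
  then show "lhom_density (costar k) P = (LINT x|lnu_plus P. x ^ k)"
    unfolding lnu_plus_def moment_degree_distr[OF fin(1,2)] lhom_density_def
    by (simp add: costar_def card_PiE)
qed

subsection \<open>Poset limits\<close>

lemma finite_poset_rep: "finite_poset (rep_uposet u)"
  using Quotient_rep_reflp[OF Quotient_uposet, of u] by (simp add: liso_fin_def)

lemma abs_rep_uposet: "abs_uposet (rep_uposet u) = u"
  by (rule Quotient_abs_rep[OF Quotient_uposet])

lemma liso_fin_refl: "finite_poset p \<Longrightarrow> liso_fin p p"
  unfolding liso_fin_def liso_def using liso_via_id by blast

lemma hom_density_abs:
  assumes "finite_poset Q"
  shows "hom_density (abs_uposet Q) u = lhom_density Q (rep_uposet u)"
  using hom_density.abs_eq[OF liso_fin_refl[OF assms] liso_fin_refl[OF finite_poset_rep[of u]]]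
  by (simp add: abs_rep_uposet)

lemma rep_uposet_eqs:
  "nu_minus u = lnu_minus (rep_uposet u)"
  "nu_plus u = lnu_plus (rep_uposet u)"
  "psize u = card (fst (rep_uposet u))"
  "semiorder u = lsemiorder (rep_uposet u)"
proof -
  note r = liso_fin_refl[OF finite_poset_rep[of u]]
  show "nu_minus u = lnu_minus (rep_uposet u)" using nu_minus.abs_eq[OF r] by (simp add: abs_rep_uposet)
  show "nu_plus u = lnu_plus (rep_uposet u)" using nu_plus.abs_eq[OF r] by (simp add: abs_rep_uposet)
  show "psize u = card (fst (rep_uposet u))" using psize.abs_eq[OF r] by (simp add: abs_rep_uposet)
  show "semiorder u = lsemiorder (rep_uposet u)" using semiorder.abs_eq[OF r] by (simp add: abs_rep_uposet)
qed

lemma psize_pos: "psize u > 0"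
  using finite_posetD(3)[OF finite_poset_rep[of u]] by (simp add: rep_uposet_eqs)

lemma finite_poset_on_initial_segment:
  assumes p: "finite_poset p"
  obtains R where "R \<subseteq> {..<card (fst p)} \<times> {..<card (fst p)}" "liso_fin p ({..<card (fst p)}, R)"
proof -
  let ?m = "card (fst p)"
  obtain k where k: "bij_betw k {..<?m} (fst p)"
    using ex_bij_betw_nat_finite[of "fst p"] finite_posetD(1)[OF p] by (auto simp: atLeast0LessThan)
  define R where "R = {(i, j). i < ?m \<and> j < ?m \<and> (k i, k j) \<in> snd p}"
  have kin: "k i \<in> fst p" if "i < ?m" for i using k that by (auto dest: bij_betwE)
  have kinj: "i = j" if "i < ?m" "j < ?m" "k i = k j" for i j
    using k that by (auto simp: bij_betw_def inj_on_def)
  have po: "trans (snd p)" "antisym (snd p)"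
    using p by (auto simp: finite_poset_def partial_order_on_def preorder_on_def)
  have "refl_on {..<?m} R" using finite_poset_refl[OF p] kin by (auto simp: refl_on_def R_def)
  moreover have "R \<subseteq> {..<?m} \<times> {..<?m}" by (auto simp: R_def)
  moreover have "trans R" using po(1) by (auto simp: R_def trans_def)
  moreover have "antisym R"
    unfolding antisym_def R_def using po(2) kinj by (auto dest: antisymD)
  ultimately have "finite_poset ({..<?m}, R)"
    using finite_posetD(3)[OF p]
    by (auto simp: finite_poset_def partial_order_on_def preorder_on_def)
  moreover have "liso_via k ({..<?m}, R) p" using k by (auto simp: liso_via_def R_def)
  ultimately have "liso_fin p ({..<?m}, R)"
    using p liso_sym[of "({..<?m}, R)" p] by (auto simp: liso_fin_def liso_def)
  then show ?thesis using that[of R] by (auto simp: R_def)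
qed

text \<open>Every class has a representative on some \<open>{..<m}\<close> with \<open>m\<close> at
  most \<open>M\<close>, and such a carrier supports only finitely many relations.\<close>

lemma finite_psize_le: "finite {u. psize u \<le> M}"
proof (rule finite_subset)
  let ?T = "\<Union>m\<in>{..M}. Pair {..<m} ` Pow ({..<m} \<times> {..<m})"
  show "{u. psize u \<le> M} \<subseteq> abs_uposet ` ?T"
  proof
    fix u assume "u \<in> {u. psize u \<le> M}"
    let ?p = "rep_uposet u"
    obtain R where R: "R \<subseteq> {..<card (fst ?p)} \<times> {..<card (fst ?p)}" "liso_fin ?p ({..<card (fst ?p)}, R)"
      using finite_poset_on_initial_segment[OF finite_poset_rep] by blast
    have "u = abs_uposet ({..<card (fst ?p)}, R)"
      using Quotient_rel_abs[OF Quotient_uposet R(2)] by (simp add: abs_rep_uposet)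
    moreover have "card (fst ?p) \<le> M" using \<open>u \<in> _\<close> by (simp add: rep_uposet_eqs)
    ultimately show "u \<in> abs_uposet ` ?T" using R(1) by blast
  qed
qed simp

section \<open>Points of the compactification\<close>

lemma continuous_on_density: "continuous_on UNIV (\<lambda>L :: ('a \<Rightarrow> real) \<times> real. fst L Q)"
  by (rule continuous_on_compose2[OF continuous_on_product_coordinates[of Q] continuous_on_fst]) auto

text \<open>Only finitely many posets have a given size, so the last coordinate of a limit vanishes;
  this is what makes \<^const>\<open>Pi_lim\<close> well defined.\<close>

lemma poset_limits_snd:
  assumes "L \<in> poset_limits"
  shows "snd L = 0"
proof -
  have cpt: "closed {L}" for L :: "(uposet \<Rightarrow> real) \<times> real"
  proof -
    have "closed {K. snd K = snd L \<and> (\<forall>Q. fst K Q = fst L Q)}"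
      by (intro closed_Collect_conj closed_Collect_all closed_Collect_eq continuous_on_density
          continuous_on_snd continuous_on_id continuous_on_const)
    also have "{K. snd K = snd L \<and> (\<forall>Q. fst K Q = fst L Q)} = {L}"
      by (auto simp: prod_eq_iff fun_eq_iff)
    finally show ?thesis .
  qed
  have small: "snd L \<le> 1 / real (Suc M)" for M
  proof -
    \<comment> \<open>Finitely many small posets together with a closed half-space form a closed set
      containing the image of every poset. A limit lies in its closure but is no poset, so it falls
      in the half-space.\<close>
    let ?S = "(\<Union>u\<in>{u. psize u \<le> M}. {poset_emb u}) \<union> {K. snd K \<le> 1 / real (Suc M)}"
    have "closed ?S"
      by (intro closed_Un closed_UN finite_psize_le ballI cpt closed_Collect_le
          continuous_on_snd continuous_on_id continuous_on_const)
    moreover have "range poset_emb \<subseteq> ?S"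
    proof
      fix K assume "K \<in> range poset_emb"
      then obtain u where u: "K = poset_emb u" by blast
      show "K \<in> ?S"
      proof (cases "psize u \<le> M")
        case False
        then have "1 / real (psize u) \<le> 1 / real (Suc M)" by (intro divide_left_mono) auto
        then show ?thesis using u by (simp add: poset_emb_def)
      qed (use u in auto)
    qed
    ultimately have "L \<in> ?S" using assms closure_minimal unfolding poset_limits_def poset_bar_def by blast
    then show ?thesis using assms by (auto simp: poset_limits_def)
  qed
  have "snd L \<le> 0"
  proof (rule LIMSEQ_le_const)
    show "(\<lambda>M. 1 / real (Suc M)) \<longlonglongrightarrow> 0" using LIMSEQ_inverse_real_of_nat by (simp add: inverse_eq_divide)
    show "\<exists>N. \<forall>n\<ge>N. snd L \<le> 1 / real (Suc n)" using small by blast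
  qed
  moreover have "0 \<le> snd L"
  proof -
    have "closed {K :: (uposet \<Rightarrow> real) \<times> real. 0 \<le> snd K}"
      by (intro closed_Collect_le continuous_on_snd continuous_on_id continuous_on_const)
    moreover have "range poset_emb \<subseteq> {K. 0 \<le> snd K}" by (auto simp: poset_emb_def)
    ultimately have "closure (range poset_emb) \<subseteq> {K. 0 \<le> snd K}" by (intro closure_minimal)
    then show ?thesis using assms by (auto simp: poset_limits_def poset_bar_def)
  qed
  ultimately show ?thesis by simp
qed

lemma tendsto_fun_componentwise:
  fixes f :: "'b \<Rightarrow> 'a \<Rightarrow> real"
  assumes "\<And>i. ((\<lambda>n. f n i) \<longlongrightarrow> l i) F"
  shows "(f \<longlongrightarrow> l) F"
proof -
  have "limitin (product_topology (\<lambda>_. euclidean) UNIV) f l F"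
    using assms by (simp add: limitin_componentwise)
  then show ?thesis by (simp add: euclidean_product_topology)
qed

text \<open>Growing sizes force the last coordinate to 0. No poset has this coordinate 0, so the
  point reached is a genuine poset limit.\<close>

lemma converges_to_limitI:
  assumes size: "filterlim (\<lambda>n. psize (P n)) at_top sequentially"
    and conv: "\<And>Q. (\<lambda>n. hom_density Q (P n)) \<longlonglongrightarrow> D Q"
  shows "converges_to_limit P (D, 0)"
proof -
  have "(\<lambda>n. 1 / real (psize (P n))) \<longlonglongrightarrow> 0"
    by (intro tendsto_divide_0[OF tendsto_const] filterlim_at_top_imp_at_infinity
        filterlim_compose[OF filterlim_real_sequentially size])
  then have lim: "(\<lambda>n. poset_emb (P n)) \<longlonglongrightarrow> (D, 0)"
    unfolding poset_emb_def using conv by (intro tendsto_Pair tendsto_fun_componentwise)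
  have "(D, 0) \<in> closure (range poset_emb)"
  proof (rule ccontr)
    let ?S = "- closure (range poset_emb)"
    assume "(D, 0) \<notin> closure (range poset_emb)"
    then have "\<forall>\<^sub>F n in sequentially. poset_emb (P n) \<in> ?S"
      using lim by (intro topological_tendstoD[of _ "(D, 0)"]) (auto simp: open_Compl)
    then obtain n where "poset_emb (P n) \<in> ?S" by (auto simp: eventually_sequentially)
    then show False using closure_subset[of "range poset_emb"] by auto
  qed
  moreover have "(D, 0) \<notin> range poset_emb" using psize_pos by (auto simp: poset_emb_def) (metis less_irrefl)
  ultimately show ?thesis using lim by (simp add: converges_to_limit_def poset_limits_def poset_bar_def)
qed

lemma converges_to_limitD:
  assumes "converges_to_limit P L"
  shows "(\<lambda>n. hom_density Q (P n)) \<longlonglongrightarrow> fst L Q"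
  using continuous_on_tendsto_compose[OF continuous_on_density[of Q], of "\<lambda>n. poset_emb (P n)" L] assms
  by (simp add: converges_to_limit_def poset_emb_def)

text \<open>The sequence itself supplies existence in the definite description. Uniqueness holds
  because the densities fix the first component and \<open>poset_limits_snd\<close> fixes the
  second.\<close>

lemma converges_to_Pi_lim:
  assumes size: "filterlim (\<lambda>n. psize (P n)) at_top sequentially"
    and conv: "\<And>Q :: nat lposet. finite_poset Q \<Longrightarrow> (\<lambda>n. lhom_density Q (rep_uposet (P n))) \<longlonglongrightarrow> W_density g Q"
  shows "converges_to_limit P (Pi_lim g)"
proof -
  define D where "D u = W_density g (rep_uposet u)" for u
  have "(\<lambda>n. hom_density u (P n)) \<longlonglongrightarrow> D u" for u
    using conv[OF finite_poset_rep[of u]] hom_density_abs[OF finite_poset_rep[of u]]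
    by (simp add: D_def abs_rep_uposet)
  then have lim: "converges_to_limit P (D, 0)" by (intro converges_to_limitI size)
  \<comment> \<open>Invariance of \<open>W_density\<close> under relabelling comes for free: both
    sides are limits of the same densities.\<close>
  have dens: "D (abs_uposet Q) = W_density g Q" if "finite_poset Q" for Q
    using converges_to_limitD[OF lim, of "abs_uposet Q"] conv[OF that]
    by (auto simp: hom_density_abs that intro: LIMSEQ_unique)
  have "Pi_lim g = (D, 0)" unfolding Pi_lim_def
  proof (rule the_equality)
    show "(D, 0) \<in> poset_limits \<and>
        (\<forall>Q. finite_poset Q \<longrightarrow> density_bar (abs_uposet Q) (D, 0) = W_density g Q)"
      using lim dens by (simp add: converges_to_limit_def density_bar_def)
    fix L assume L: "L \<in> poset_limits \<and>
        (\<forall>Q. finite_poset Q \<longrightarrow> density_bar (abs_uposet Q) L = W_density g Q)"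
    have "fst L u = D u" for u
      using conjunct2[OF L, rule_format, OF finite_poset_rep[of u]]
      by (simp add: D_def density_bar_def abs_rep_uposet)
    then show "L = (D, 0)" using poset_limits_snd L by (auto simp: prod_eq_iff)
  qed
  then show ?thesis using lim by simp
qed

subsection \<open>The generalised inverse of a distribution function\<close>

text \<open>The bound passes to the limit at irrational continuity points right of \<open>x\<close>,
  then to \<open>x\<close> by right continuity. The point 1 is separate, as nothing in the open
  interval lies to its right.\<close>

lemma cdf_ge_identity_weak_limit:
  assumes \<nu>: "unit_distribution \<nu>" "weak_conv_m \<mu> \<nu>"
    and ge: "\<And>n z. 0 < z \<Longrightarrow> z < 1 \<Longrightarrow> z \<notin> \<rat> \<Longrightarrow> z \<le> cdf (\<mu> n) z" and x: "x \<in> {0..1}"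
  shows "x \<le> cdf \<nu> x"
proof (cases "x = 1")
  case True
  then show ?thesis using unit_distribution_cdf(2)[OF \<nu>(1), of 1] by simp
next
  case False
  have d: "real_distribution \<nu>" using \<nu> by (simp add: unit_distribution_def)
  show ?thesis
  proof (rule cdf_ge_of_right_dense[OF d, where b = 1 and C = "\<rat> \<union> {z. \<not> isCont (cdf \<nu>) z}"])
    show "countable (\<rat> \<union> {z. \<not> isCont (cdf \<nu>) z})"
      using countable_cdf_discont[OF d] countable_rat by simp
    fix z assume z: "x < z" "z < 1" "z \<notin> \<rat> \<union> {z. \<not> isCont (cdf \<nu>) z}"
    then have "(\<lambda>n. cdf (\<mu> n) z) \<longlonglongrightarrow> cdf \<nu> z"
      using \<nu>(2) by (auto simp: weak_conv_m_def weak_conv_def)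
    then have "z \<le> cdf \<nu> z" using ge[of z] z x by (intro LIMSEQ_le_const) auto
    then show "x \<le> cdf \<nu> z" using z by simp
  qed (use x False in auto)
qed

text \<open>The set contains 0 because the distribution function is 1 at 1. Its supremum is attained
  because \<open>1 - s\<close> approaches \<open>1 - Sup\<close> from the right, where the
  distribution function is continuous.\<close>

lemma is_max_max_set:
  assumes \<nu>: "unit_distribution \<nu>" and x: "0 \<le> x"
  shows "is_max (max_set (cdf \<nu>) x) (Sup (max_set (cdf \<nu>) x))"
proof -
  let ?S = "max_set (cdf \<nu>) x"
  have d: "real_distribution \<nu>" using \<nu> by (simp add: unit_distribution_def)
  have z: "0 \<in> ?S" using unit_distribution_cdf(2)[OF \<nu>, of 1] x by (simp add: max_set_def)
  have b: "bdd_above ?S" by (rule bdd_aboveI[of _ 1]) (simp add: max_set_def)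
  have "0 \<le> Sup ?S" using z b by (rule cSup_upper)
  moreover have "Sup ?S \<le> 1" using z by (intro cSup_least) (blast, simp add: max_set_def)
  moreover have "1 - x \<le> cdf \<nu> (1 - Sup ?S)"
  \<comment> \<open>The bound holds at every point to the right, so no exceptions are needed and
    \<open>b\<close> is just some larger number.\<close>
  proof (rule cdf_ge_of_right_dense[OF d, where b = "2 - Sup ?S" and C = "{}"])
    fix t assume "1 - Sup ?S < t"
    then have "1 - t < Sup ?S" by simp
    then obtain s where s: "s \<in> ?S" "1 - t < s" using less_cSupD[of ?S "1 - t"] z by blast
    then have "cdf \<nu> (1 - s) \<le> cdf \<nu> t" by (intro monoD[OF mono_cdf[OF d]]) simp
    then show "1 - x \<le> cdf \<nu> t" using s by (simp add: max_set_def)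
  qed simp_all
  ultimately have "Sup ?S \<in> ?S" by (simp add: max_set_def)
  then show ?thesis using cSup_upper[OF _ b] by (simp add: is_max_def)
qed

lemma min_set_eq_image: "min_set F x = (\<lambda>s. 1 - s) ` max_set F x"
proof -
  have "t \<in> min_set F x \<longleftrightarrow> 1 - t \<in> max_set F x" for t by (auto simp: min_set_def max_set_def)
  then show ?thesis by (force simp: image_iff)
qed

lemma is_min_min_set: "is_max (max_set F x) m \<Longrightarrow> is_min (min_set F x) (1 - m)"
  by (auto simp: is_max_def is_min_def min_set_eq_image)

text \<open>Infima and suprema replace minima and maxima so that the reflection also applies to
  upper limits, whose sets may lack extremal elements.\<close>

lemma Inf_min_set:
  assumes "max_set F x \<noteq> {}"
  shows "Inf (min_set F x) = 1 - Sup (max_set F x)"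
proof (rule cInf_eq_non_empty)
  have b: "bdd_above (max_set F x)" by (rule bdd_aboveI[of _ 1]) (simp add: max_set_def)
  show "min_set F x \<noteq> {}" using assms by (simp add: min_set_eq_image)
  fix t assume "t \<in> min_set F x"
  then show "1 - Sup (max_set F x) \<le> t" using cSup_upper[OF _ b] by (force simp: min_set_eq_image)
next
  fix y assume y: "\<And>t. t \<in> min_set F x \<Longrightarrow> y \<le> t"
  have "Sup (max_set F x) \<le> 1 - y"
    using assms y by (intro cSup_least) (force simp: min_set_eq_image)+
  then show "y \<le> 1 - Sup (max_set F x)" by simp
qed

text \<open>The bounds 0 and 1 keep both upper limits finite, so that the conversion to reals
  preserves their order.\<close>

lemma limsup_cdf_mono:
  assumes "\<And>n. real_distribution (\<mu> n)" "s \<le> t"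
  shows "limsup_cdf \<mu> s \<le> limsup_cdf \<mu> t"
proof -
  have ub: "cdf (\<mu> n) z \<le> 1" and lb: "0 \<le> cdf (\<mu> n) z" for n z
    using real_distribution.cdf_bounded_prob[OF assms(1)]
      finite_borel_measure.cdf_nonneg[OF real_distribution.finite_borel_measure_M[OF assms(1)]] by auto
  have "limsup (\<lambda>n. ereal (cdf (\<mu> n) t)) \<le> 1"
    by (intro Limsup_bounded always_eventually) (simp add: ub one_ereal_def)
  moreover have "0 \<le> limsup (\<lambda>n. ereal (cdf (\<mu> n) s))"
    by (intro le_Limsup always_eventually) (auto simp: lb zero_ereal_def)
  moreover have "limsup (\<lambda>n. ereal (cdf (\<mu> n) s)) \<le> limsup (\<lambda>n. ereal (cdf (\<mu> n) t))"
    by (intro Limsup_mono always_eventually) (use assms mono_cdf in \<open>auto dest: monoD\<close>)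
  ultimately show ?thesis unfolding limsup_cdf_def
    by (intro real_of_ereal_positive_mono) auto
qed

lemma limsup_cdf_eq:
  assumes "(\<lambda>n. cdf (\<mu> n) t) \<longlonglongrightarrow> l"
  shows "limsup_cdf \<mu> t = l"
proof -
  have "limsup (\<lambda>n. ereal (cdf (\<mu> n) t)) = ereal l"
    using assms by (intro lim_imp_Limsup) auto
  then show ?thesis by (simp add: limsup_cdf_def)
qed

text \<open>The upper limit \<open>H\<close> may differ from the distribution function \<open>G\<close> at jumps, but
  \<open>H \<le> G\<close> everywhere with equality on a dense set, which suffices for the suprema to agree.\<close>

lemma Sup_max_set_limsup:
  assumes u: "\<And>n. unit_distribution (\<mu> n)" and \<nu>: "unit_distribution \<nu>" "weak_conv_m \<mu> \<nu>" and x: "0 \<le> x"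
  shows "0 \<in> max_set (limsup_cdf \<mu>) x"
    and "Sup (max_set (limsup_cdf \<mu>) x) = Sup (max_set (cdf \<nu>) x)"
proof -
  let ?H = "limsup_cdf \<mu>" and ?G = "cdf \<nu>" and ?C = "{z. \<not> isCont (cdf \<nu>) z}"
  have d: "real_distribution \<nu>" and d': "real_distribution (\<mu> n)" for n
    using \<nu> u by (simp_all add: unit_distribution_def)
  have C: "countable ?C" by (rule countable_cdf_discont[OF d])
  have eq: "?H z = ?G z" if "z \<notin> ?C" for z
    using that \<nu>(2) by (intro limsup_cdf_eq) (auto simp: weak_conv_m_def weak_conv_def)
  have le: "?H t \<le> ?G t" for t
  \<comment> \<open>At continuity points \<open>z\<close> right of \<open>t\<close>, monotonicity
    gives \<open>?H t \<le> ?H z = ?G z\<close>; right continuity of \<open>?G\<close> brings this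
    back to \<open>t\<close>.\<close>
  proof (rule cdf_ge_of_right_dense[OF d C, where b = "t + 1"])
    fix z assume "t < z" "z \<notin> ?C"
    then show "?H t \<le> ?G z" using limsup_cdf_mono[of \<mu> t z] d' eq[of z] by simp
  qed simp
  have "?H 1 = 1" using unit_distribution_cdf(2)[OF u, of 1] by (intro limsup_cdf_eq) simp
  then show z: "0 \<in> max_set ?H x" using x by (simp add: max_set_def)
  define m where "m = Sup (max_set ?G x)"
  have m: "m \<in> max_set ?G x" "\<And>s. s \<in> max_set ?G x \<Longrightarrow> s \<le> m"
    using is_max_max_set[OF \<nu>(1) x] by (auto simp: is_max_def m_def)
  have "Sup (max_set ?H x) = m"
  proof (rule cSup_eq_non_empty)
    show "max_set ?H x \<noteq> {}" using z by blast
    fix s assume "s \<in> max_set ?H x"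
    then have "s \<in> max_set ?G x" using le[of "1 - s"] by (simp add: max_set_def)
    then show "s \<le> m" by (rule m(2))
  next
    fix y assume y: "\<And>s. s \<in> max_set ?H x \<Longrightarrow> s \<le> y"
    show "m \<le> y"
    proof (rule ccontr)
      assume "\<not> m \<le> y"
      then have "uncountable {y<..<m}" by (simp add: uncountable_open_interval)
      \<comment> \<open>Choose \<open>s\<close> just below the maximum \<open>m\<close> so that
        \<open>1 - s\<close> is a continuity point. There both functions agree, and
        \<open>?G (1 - s)\<close> is at least \<open>?G (1 - m)\<close>.\<close>
      then obtain s where s: "s \<in> {y<..<m}" "s \<notin> (\<lambda>z. 1 - z) ` ?C"
        using countable_image[OF C, of "\<lambda>z. 1 - z"] by (meson countable_subset subsetI)
      then have "1 - s \<notin> ?C" by (force simp: image_iff)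
      then have "?H (1 - s) = ?G (1 - s)" by (rule eq)
      moreover have "?G (1 - m) \<le> ?G (1 - s)" using s by (intro monoD[OF mono_cdf[OF d]]) simp
      ultimately have "s \<in> max_set ?H x" using m(1) s y[OF z] by (auto simp: max_set_def)
      then show False using y[of s] s by simp
    qed
  qed
  then show "Sup (max_set ?H x) = Sup (max_set ?G x)" by (simp add: m_def)
qed

theorem theorem5p12:
  fixes P :: "nat \<Rightarrow> uposet"
  assumes semi: "\<And>n. semiorder (P n)"
    and size: "filterlim (\<lambda>n. psize (P n)) at_top sequentially"
  shows
    "((\<exists>L. converges_to_limit P L) \<longleftrightarrow>
        (\<exists>\<nu>. unit_distribution \<nu> \<and> weak_conv_m (\<lambda>n. nu_minus (P n)) \<nu>)) \<and>
     ((\<exists>L. converges_to_limit P L) \<longleftrightarrow>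
        (\<exists>\<nu>. unit_distribution \<nu> \<and> weak_conv_m (\<lambda>n. nu_plus (P n)) \<nu>)) \<and>
     (\<forall>L. converges_to_limit P L \<longrightarrow> semiorder_limit L) \<and>
     (\<forall>\<nu>. unit_distribution \<nu> \<and> weak_conv_m (\<lambda>n. nu_minus (P n)) \<nu> \<longrightarrow>
        admissible (cdf \<nu>) \<and> converges_to_limit P (Pi_lim (cdf \<nu>)) \<and>
        (\<forall>t. isCont (cdf \<nu>) t \<longrightarrow> (\<lambda>n. cdf (nu_minus (P n)) t) \<longlonglongrightarrow> cdf \<nu> t)) \<and>
     (\<forall>\<nu>. unit_distribution \<nu> \<and> weak_conv_m (\<lambda>n. nu_plus (P n)) \<nu> \<longrightarrow>
        (\<exists>g. admissible g \<and> converges_to_limit P (Pi_lim g) \<and>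
             (\<forall>x\<in>{0..1}. is_min (min_set (cdf \<nu>) x) (1 - g x) \<and>
                          is_max (max_set (cdf \<nu>) x) (g x)) \<and>
             (\<forall>x\<in>{0..1}. g x = 1 - Inf (min_set (limsup_cdf (\<lambda>n. nu_plus (P n))) x) \<and>
                          g x = Sup (max_set (limsup_cdf (\<lambda>n. nu_plus (P n))) x))) \<and>
        (\<forall>t. isCont (cdf \<nu>) t \<longrightarrow> (\<lambda>n. cdf (nu_plus (P n)) t) \<longlonglongrightarrow> cdf \<nu> t))"
proof -
  define p where "p n = rep_uposet (P n)" for n
  have p: "finite_poset (p n)" "lsemiorder (p n)" for n
    using finite_poset_rep semi by (simp_all add: p_def rep_uposet_eqs)
  have nu: "nu_minus (P n) = lnu_minus (p n)" "nu_plus (P n) = lnu_plus (p n)" for n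
    by (simp_all add: p_def rep_uposet_eqs)
  have minus: "admissible (cdf \<nu>) \<and> converges_to_limit P (Pi_lim (cdf \<nu>))"
    if \<nu>: "unit_distribution \<nu>" "weak_conv_m (\<lambda>n. nu_minus (P n)) \<nu>" for \<nu>
  proof
    interpret real_distribution \<nu> using \<nu>(1) by (simp add: unit_distribution_def)
    have "x \<le> cdf \<nu> x" if "x \<in> {0..1}" for x
      using semiorder_cdf_ge(1)[OF p] that
      by (intro cdf_ge_identity_weak_limit[OF \<nu>]) (auto simp: nu)
    then show "admissible (cdf \<nu>)"
      unfolding admissible_def using cdf_nonneg cdf_bounded_prob cdf_nondecreasing
      by (auto simp: mono_on_def)
    show "converges_to_limit P (Pi_lim (cdf \<nu>))"
    proof (rule converges_to_Pi_lim[OF size])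
      fix Q :: "nat lposet" assume Q: "finite_poset Q"
      then show "(\<lambda>n. lhom_density Q (rep_uposet (P n))) \<longlonglongrightarrow> W_density (cdf \<nu>) Q"
        using semiorder_density_tendsto_minus[OF p Q real_distribution_axioms \<nu>(2)[unfolded nu]]
          W_density_eq_kernel_density[of Q "cdf \<nu>" "\<lambda>x y. cdf \<nu> x < y"] finite_posetD(1)[OF Q]
        by (simp add: p_def)
    qed
  qed
  have plus: "\<exists>g. admissible g \<and> converges_to_limit P (Pi_lim g) \<and>
             (\<forall>x\<in>{0..1}. is_min (min_set (cdf \<nu>) x) (1 - g x) \<and>
                          is_max (max_set (cdf \<nu>) x) (g x)) \<and>
             (\<forall>x\<in>{0..1}. g x = 1 - Inf (min_set (limsup_cdf (\<lambda>n. nu_plus (P n))) x) \<and>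
                          g x = Sup (max_set (limsup_cdf (\<lambda>n. nu_plus (P n))) x))"
    if \<nu>: "unit_distribution \<nu>" "weak_conv_m (\<lambda>n. nu_plus (P n)) \<nu>" for \<nu>
  proof -
    interpret real_distribution \<nu> using \<nu>(1) by (simp add: unit_distribution_def)
    define g where "g x = Sup (max_set (cdf \<nu>) x)" for x
    have mx: "is_max (max_set (cdf \<nu>) x) (g x)" if "x \<in> {0..1}" for x
      unfolding g_def using that by (intro is_max_max_set[OF \<nu>(1)]) simp
    have g01: "g x \<in> {0..1}" if "x \<in> {0..1}" for x
      using mx[OF that] by (auto simp: is_max_def max_set_def)
    have ge: "x \<le> cdf \<nu> x" if "x \<in> {0..1}" for x
      using semiorder_cdf_ge(2)[OF p] that
      by (intro cdf_ge_identity_weak_limit[OF \<nu>]) (auto simp: nu)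
    have "x \<le> g x" if "x \<in> {0..1}" for x
    proof -
      \<comment> \<open>The lower bound at \<open>1 - x\<close> says that \<open>x\<close> itself
        competes for the maximum.\<close>
      have "x \<in> max_set (cdf \<nu>) x" using ge[of "1 - x"] that by (simp add: max_set_def)
      then show ?thesis using mx[OF that] by (simp add: is_max_def)
    qed
    moreover have "g x \<le> g y" if "x \<in> {0..1}" "y \<in> {0..1}" "x \<le> y" for x y
    proof -
      have "g x \<in> max_set (cdf \<nu>) y" using mx[OF that(1)] that(3) by (auto simp: is_max_def max_set_def)
      then show ?thesis using mx[OF that(2)] by (simp add: is_max_def)
    qed
    ultimately have "admissible g" using g01 unfolding admissible_def by (auto simp: mono_on_def)
    moreover have "converges_to_limit P (Pi_lim g)"
    proof (rule converges_to_Pi_lim[OF size])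
      fix Q :: "nat lposet" assume Q: "finite_poset Q"
      have "g x < y \<longleftrightarrow> cdf \<nu> (1 - y) < 1 - x" if "x \<in> {0..1}" "y \<in> {0..1}" for x y
      proof -
        \<comment> \<open>This is the adjunction of a generalised inverse: attainment of the maximum
          gives one direction, maximality the other. It identifies the up-degree kernel with
          \<open>W g\<close> on the unit square.\<close>
        have "y \<le> g x \<longleftrightarrow> 1 - x \<le> cdf \<nu> (1 - y)"
        proof
          assume "y \<le> g x"
          then have "cdf \<nu> (1 - g x) \<le> cdf \<nu> (1 - y)" by (intro cdf_nondecreasing) simp
          then show "1 - x \<le> cdf \<nu> (1 - y)" using mx[OF that(1)] by (auto simp: is_max_def max_set_def)
        next
          assume "1 - x \<le> cdf \<nu> (1 - y)"
          then have "y \<in> max_set (cdf \<nu>) x" using that by (simp add: max_set_def)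
          then show "y \<le> g x" using mx[OF that(1)] by (simp add: is_max_def)
        qed
        then show ?thesis by linarith
      qed
      then have "W_density g Q = kernel_density (\<lambda>x y. cdf \<nu> (1 - y) < 1 - x) Q"
        using finite_posetD(1)[OF Q] by (intro W_density_eq_kernel_density) auto
      then show "(\<lambda>n. lhom_density Q (rep_uposet (P n))) \<longlonglongrightarrow> W_density g Q"
        using semiorder_density_tendsto_plus[OF p Q real_distribution_axioms \<nu>(2)[unfolded nu]]
        by (simp add: p_def)
    qed
    moreover have "g x = 1 - Inf (min_set (limsup_cdf (\<lambda>n. nu_plus (P n))) x) \<and>
        g x = Sup (max_set (limsup_cdf (\<lambda>n. nu_plus (P n))) x)" if "x \<in> {0..1}" for x
    proof -
      have S: "0 \<in> max_set (limsup_cdf (\<lambda>n. nu_plus (P n))) x"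
          "Sup (max_set (limsup_cdf (\<lambda>n. nu_plus (P n))) x) = g x"
        unfolding g_def using Sup_max_set_limsup[OF _ \<nu>, of x] unit_distribution_lnu(2)[OF p(1)] that
        by (auto simp: nu)
      then have "Inf (min_set (limsup_cdf (\<lambda>n. nu_plus (P n))) x) = 1 - g x"
        by (subst Inf_min_set) auto
      then show ?thesis using S by simp
    qed
    ultimately show ?thesis using mx is_min_min_set by (intro exI[of _ g]) blast
  qed
  have conv: "\<exists>\<nu>. unit_distribution \<nu> \<and> weak_conv_m (\<lambda>n. nu_minus (P n)) \<nu>"
    "\<exists>\<nu>. unit_distribution \<nu> \<and> weak_conv_m (\<lambda>n. nu_plus (P n)) \<nu>"
    if "converges_to_limit P L" for L
  proof -
    have dens: "convergent (\<lambda>n. lhom_density Q (p n))" if "finite_poset Q" for Q :: "nat lposet"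
      using converges_to_limitD[OF \<open>converges_to_limit P L\<close>, of "abs_uposet Q"]
      by (auto simp: hom_density_abs that p_def convergent_def)
    \<comment> \<open>Star densities converge along with all others, and they are exactly the
      moments of the down-degree distributions.\<close>
    show "\<exists>\<nu>. unit_distribution \<nu> \<and> weak_conv_m (\<lambda>n. nu_minus (P n)) \<nu>"
      unfolding nu using dens[OF finite_poset_star(1)] lhom_density_star(1)[OF p(1)]
      by (intro weak_conv_of_moments unit_distribution_lnu p) simp
    show "\<exists>\<nu>. unit_distribution \<nu> \<and> weak_conv_m (\<lambda>n. nu_plus (P n)) \<nu>"
      unfolding nu using dens[OF finite_poset_star(2)] lhom_density_star(2)[OF p(1)]
      by (intro weak_conv_of_moments unit_distribution_lnu p) simp
  qed
  \<comment> \<open>The given sequence already consists of semiorders, so it serves as its own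
    witness.\<close>
  have "semiorder_limit L" if "converges_to_limit P L" for L
    using that semi by (auto simp: semiorder_limit_def)
  moreover have "(\<lambda>n. cdf (\<mu> n) t) \<longlonglongrightarrow> cdf \<nu> t" if "weak_conv_m \<mu> \<nu>" "isCont (cdf \<nu>) t" for \<mu> \<nu> t
    using that by (simp add: weak_conv_m_def weak_conv_def)
  ultimately show ?thesis using minus plus conv by (intro conjI) blast+
qed

end
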